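(* Let $q$ be a power of an odd prime, let $m=\frac{q+1}{2}$, and let $i\in\mathbb{Z}$ with $\gcd(i,m)=\gcd(i+2,m)=1$. The Weierstrass semigroups at the places $P_0$ and $P_\infty$ of $\mathcal{F}_i$ are generated (as subsemigroups of $\mathbb{Z}_{\ge0}$ containing $0$) as follows: $$H(P_0)=\left\langle m,\ \left\lceil \frac{\ell(i+2)}{m}\right\rceil m-\ell i \ \Big|\ 1 \le \ell \le m-1 \right\rangle$$ and $$H(P_\infty)=\left\langle m,\ -\left\lfloor \frac{\ell i}{m}\right\rfloor m+\ell (i+2) \ \Big|\ 1 \le \ell \le m-1 \right\rangle.$$
   Context: $\mathcal{F}_i=\mathbb{F}_{q^2}(x,y)$ is the function field over $\mathbb{F}_{q^2}$ defined by $y^m=x^i(x^2+1)$. $P_0$ (resp. $P_\infty$) denotes the unique zero (resp. unique pole) of $x$ in $\mathcal{F}_i$; both are places of degree one. For a place $P$ of degree one, $H(P)$ is the Weierstrass semigroup at $P$: the set of integers $n\ge 0$ for which there is a function with pole divisor exactly $nP$. *)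

theory Defs
  imports Complex_Main "HOL-Computational_Algebra.Computational_Algebra" "HOL.Hull"
begin

text \<open>
  A function field is given by a type \<open>'a\<close> of class \<open>field\<close> together with its field of
  constants, a subset \<open>K\<close> of \<open>'a\<close>.  Valuation rings, places, valuations and pole divisors follow
  Stichtenoth, \<^emph>\<open>Algebraic Function Fields and Codes\<close>, Chapter 1.
\<close>

definition is_subring :: "'a::field set \<Rightarrow> bool" where
  "is_subring S \<longleftrightarrow> 0 \<in> S \<and> 1 \<in> S \<and> (\<forall>a\<in>S. - a \<in> S) \<and>
     (\<forall>a\<in>S. \<forall>b\<in>S. a + b \<in> S) \<and> (\<forall>a\<in>S. \<forall>b\<in>S. a * b \<in> S)"

definition is_subfield :: "'a::field set \<Rightarrow> bool" where
  "is_subfield S \<longleftrightarrow> is_subring S \<and> (\<forall>a\<in>S. inverse a \<in> S)"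

definition transcendental_over :: "'a::field set \<Rightarrow> 'a \<Rightarrow> bool" where
  "transcendental_over K x \<longleftrightarrow> (\<forall>p. (\<forall>n. coeff p n \<in> K) \<and> p \<noteq> 0 \<longrightarrow> poly p x \<noteq> 0)"

definition valuation_ring :: "'a::field set \<Rightarrow> 'a set \<Rightarrow> bool" where
  "valuation_ring K R \<longleftrightarrow> is_subring R \<and> K \<subset> R \<and> R \<subset> UNIV \<and> (\<forall>z. z \<in> R \<or> inverse z \<in> R)"

text \<open>A place is the maximal ideal of a valuation ring, that is, its set of nonunits.\<close>

definition is_place :: "'a::field set \<Rightarrow> 'a set \<Rightarrow> bool" where
  "is_place K P \<longleftrightarrow> (\<exists>R. valuation_ring K R \<and> P = {z \<in> R. z = 0 \<or> inverse z \<notin> R})"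

text \<open>The valuation ring is recovered from its maximal ideal.  The case \<open>z = 0\<close> is separate because
  \<open>inverse 0 = 0\<close>.\<close>

definition ring_at :: "'a::field set \<Rightarrow> 'a set" where
  "ring_at P = {z. z = 0 \<or> inverse z \<notin> P}"

text \<open>The valuation \<open>n\<close> of \<open>z \<noteq> 0\<close> is read off from \<open>z = t\<^sup>n u\<close> with \<open>t\<close> a generator of \<open>P\<close> and \<open>u\<close> a
  unit at \<open>P\<close>.  It is meaningless for \<open>z = 0\<close>.\<close>

definition val_at :: "'a::field set \<Rightarrow> 'a \<Rightarrow> int" where
  "val_at P z = (THE n. \<exists>t u. P = (\<lambda>a. t * a) ` ring_at P \<and> u \<in> ring_at P - P \<and> z = t powi n * u)"

text \<open>Divisors are integer-valued functions on places, extended by \<open>0\<close> to all other sets.\<close>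

definition pole_divisor :: "'a::field set \<Rightarrow> 'a \<Rightarrow> 'a set \<Rightarrow> int" where
  "pole_divisor K f = (\<lambda>Q. if is_place K Q \<and> val_at Q f < 0 then - val_at Q f else 0)"

definition weierstrass_semigroup :: "'a::field set \<Rightarrow> 'a set \<Rightarrow> int set" where
  "weierstrass_semigroup K P =
     {n. n \<ge> 0 \<and> (\<exists>f. f \<noteq> 0 \<and> pole_divisor K f = (\<lambda>Q. if Q = P then n else 0))}"

definition the_zero :: "'a::field set \<Rightarrow> 'a \<Rightarrow> 'a set" where
  "the_zero K f = (THE P. is_place K P \<and> val_at P f > 0)"

definition the_pole :: "'a::field set \<Rightarrow> 'a \<Rightarrow> 'a set" where
  "the_pole K f = (THE P. is_place K P \<and> val_at P f < 0)"

definition is_subsemigroup :: "int set \<Rightarrow> bool" where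
  "is_subsemigroup S \<longleftrightarrow> 0 \<in> S \<and> (\<forall>a\<in>S. \<forall>b\<in>S. a + b \<in> S)"

end

theory Submission
  imports Defs
begin

text \<open>
  Over \<open>K(x)\<close> the functions \<open>1, y, \<dots>, y^(m-1)\<close> form a basis of the field.  The place \<open>P\<^sub>0\<close> is totally
  ramified, with \<open>v\<^sub>0(x) = m\<close> and \<open>v\<^sub>0(y) = i\<close>, so the terms of
  \<open>f = \<Sum>\<^sub>j h\<^sub>j y^j\<close> have pairwise distinct valuations modulo \<open>m\<close> at \<open>P\<^sub>0\<close>, and \<open>v\<^sub>0(f)\<close> is the least
  of them.  If \<open>f\<close> has poles only at \<open>P\<^sub>0\<close>, it is integral over \<open>K[1/x]\<close>; averaging over the
  conjugates \<open>\<zeta> y\<close> of \<open>y\<close>, where \<open>\<zeta>\<close> runs through the \<open>m\<close>-th roots of unity (all in \<open>K\<close>), shows that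
  every term \<open>h\<^sub>j y^j\<close> is integral too.  As \<open>x\<^sup>2 + 1\<close> is squarefree, this forces
  \<open>h\<^sub>j = x^(-s) D(x)\<close> with a polynomial \<open>D\<close>, \<open>D(0) \<noteq> 0\<close>, and regularity at the poles of \<open>x\<close>
  yields \<open>s m \<ge> j (i + 2)\<close>.  The pole order of the term is \<open>s m - j i\<close>, and \<open>x^(-s) y^j\<close> attains it.
  The substitution \<open>x \<mapsto> 1/x\<close>, \<open>i \<mapsto> - i - 2\<close> preserves the equation and exchanges \<open>P\<^sub>0\<close> and \<open>P\<^sub>\<infinity>\<close>.
\<close>

section \<open>Polynomials with coefficients in a subring\<close>

text \<open>The definitions quantify over all valuation rings, so facts about arbitrary places are
  needed: Zorn's lemma supplies enough of them, and each is discrete because every function is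
  algebraic of degree at most \<open>m\<close> over \<open>K(x)\<close>. Away from
  \<open>P_0\<close> poles of different terms of \<open>f\<close> might cancel, so regularity of
  \<open>f\<close> does not pass to its terms directly; this is why integrality enters. No
  conjugation automorphism is built: an integral equation is carried to the conjugates of
  \<open>y\<close> as a polynomial relation modulo \<open>Y^m - y^m\<close>. The roots of unity are
  present because \<open>q + 1 = 2 * m\<close> gives \<open>card K - 1 = (q - 1) * (2 * m)\<close>.
  Coprimality of \<open>i\<close> and \<open>m\<close> yields total ramification over
  \<open>x = 0\<close>, that of \<open>i + 2\<close> and \<open>m\<close> does so at infinity, and
  oddness of \<open>q\<close> makes \<open>x^2 + 1\<close> squarefree. For fixed \<open>j\<close>
  the ceiling in the generators is the least admissible \<open>s\<close>; larger \<open>s\<close>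
  only add multiples of \<open>m\<close>.\<close>

lemma
  assumes "is_subring S"
  shows subring_0: "0 \<in> S" and subring_1: "1 \<in> S"
    and subring_uminus: "a \<in> S \<Longrightarrow> - a \<in> S"
    and subring_add: "a \<in> S \<Longrightarrow> b \<in> S \<Longrightarrow> a + b \<in> S"
    and subring_mult: "a \<in> S \<Longrightarrow> b \<in> S \<Longrightarrow> a * b \<in> S"
  using assms by (auto simp: is_subring_def)

lemma subring_diff: "is_subring S \<Longrightarrow> a \<in> S \<Longrightarrow> b \<in> S \<Longrightarrow> a - b \<in> S"
  using subring_add[of S a "- b"] subring_uminus by auto

lemma subring_power: "is_subring S \<Longrightarrow> a \<in> S \<Longrightarrow> a ^ n \<in> S"
  by (induction n) (auto simp: subring_1 subring_mult)

lemma subring_sum: "is_subring S \<Longrightarrow> (\<And>k. k \<in> I \<Longrightarrow> g k \<in> S) \<Longrightarrow> sum g I \<in> S"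
  by (induction I rule: infinite_finite_induct) (auto simp: subring_0 subring_add)

lemma subfield_subring: "is_subfield S \<Longrightarrow> is_subring S"
  by (simp add: is_subfield_def)

lemma subfield_inverse: "is_subfield S \<Longrightarrow> a \<in> S \<Longrightarrow> inverse a \<in> S"
  by (simp add: is_subfield_def)

lemma subfield_divide: "is_subfield S \<Longrightarrow> a \<in> S \<Longrightarrow> b \<in> S \<Longrightarrow> a / b \<in> S"
  by (simp add: is_subfield_def subring_mult divide_inverse)

lemma subfield_powi: "is_subfield S \<Longrightarrow> a \<in> S \<Longrightarrow> a powi n \<in> S"
  by (auto simp: power_int_def subfield_inverse subfield_subring subring_power)

definition polys_over :: "'a::field set \<Rightarrow> 'a poly set" where
  "polys_over S = {p. \<forall>n. coeff p n \<in> S}"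

context
  fixes S :: "'a::field set"
  assumes S: "is_subring S"
begin

lemma polys_over_0: "0 \<in> polys_over S"
  by (simp add: polys_over_def subring_0[OF S])

lemma polys_over_pCons: "pCons a p \<in> polys_over S \<longleftrightarrow> a \<in> S \<and> p \<in> polys_over S"
proof
  assume "pCons a p \<in> polys_over S"
  then have *: "coeff (pCons a p) n \<in> S" for n
    by (simp add: polys_over_def)
  from *[of 0] *[of "Suc _"] show "a \<in> S \<and> p \<in> polys_over S"
    by (auto simp: polys_over_def)
qed (auto simp: polys_over_def coeff_pCons split: nat.split)

lemma polys_over_1: "1 \<in> polys_over S"
  by (simp add: one_pCons polys_over_pCons polys_over_0 subring_1[OF S])

lemma polys_over_add: "p \<in> polys_over S \<Longrightarrow> r \<in> polys_over S \<Longrightarrow> p + r \<in> polys_over S"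
  by (simp add: polys_over_def subring_add[OF S])

lemma polys_over_diff: "p \<in> polys_over S \<Longrightarrow> r \<in> polys_over S \<Longrightarrow> p - r \<in> polys_over S"
  by (simp add: polys_over_def subring_diff[OF S])

lemma polys_over_uminus: "p \<in> polys_over S \<Longrightarrow> - p \<in> polys_over S"
  by (simp add: polys_over_def subring_uminus[OF S])

lemma polys_over_smult: "a \<in> S \<Longrightarrow> p \<in> polys_over S \<Longrightarrow> smult a p \<in> polys_over S"
  by (simp add: polys_over_def subring_mult[OF S])

lemma polys_over_mult: "p \<in> polys_over S \<Longrightarrow> r \<in> polys_over S \<Longrightarrow> p * r \<in> polys_over S"
  by (auto simp: polys_over_def coeff_mult intro!: subring_sum[OF S] subring_mult[OF S])

lemma polys_over_monom: "a \<in> S \<Longrightarrow> monom a n \<in> polys_over S"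
  by (simp add: polys_over_def subring_0[OF S])

lemma polys_over_sum: "(\<And>k. k \<in> I \<Longrightarrow> g k \<in> polys_over S) \<Longrightarrow> sum g I \<in> polys_over S"
  by (induction I rule: infinite_finite_induct) (auto simp: polys_over_0 polys_over_add)

lemma polys_over_pcompose: "p \<in> polys_over S \<Longrightarrow> r \<in> polys_over S \<Longrightarrow> pcompose p r \<in> polys_over S"
  by (induction p)
    (auto simp: polys_over_0 pcompose_pCons polys_over_pCons polys_over_add polys_over_mult)

lemma poly_in_subring: "p \<in> polys_over S \<Longrightarrow> z \<in> S \<Longrightarrow> poly p z \<in> S"
  by (induction p)
    (auto simp: polys_over_pCons subring_0[OF S] subring_add[OF S] subring_mult[OF S])

text \<open>Long division never leaves \<open>S\<close> because \<open>d\<close> is monic: the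
  remainder is shifted by one place and a multiple of \<open>d\<close> cancels its coefficient at
  \<open>degree d\<close>. Bounding the remainder by vanishing coefficients also covers
  \<open>degree d = 0\<close>, where it must be \<open>0\<close>.\<close>

lemma polys_over_division:
  assumes d: "d \<in> polys_over S" "lead_coeff d = 1" and p: "p \<in> polys_over S"
  shows "\<exists>s\<in>polys_over S. \<exists>r\<in>polys_over S. p = d * s + r \<and> (\<forall>n\<ge>degree d. coeff r n = 0)"
  using p
proof (induction p)
  case 0
  show ?case
    by (intro bexI[of _ 0]) (auto simp: polys_over_0)
next
  case (pCons a p)
  then obtain s r where sr: "s \<in> polys_over S" "r \<in> polys_over S" "p = d * s + r"
      "\<And>n. n \<ge> degree d \<Longrightarrow> coeff r n = 0"
    by (auto simp: polys_over_pCons)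
  define c where "c = coeff (pCons a r) (degree d)"
  have ar: "pCons a r \<in> polys_over S"
    using pCons.prems sr(2) by (simp add: polys_over_pCons)
  then have c: "c \<in> S"
    by (simp add: c_def polys_over_def)
  have "coeff (pCons a r - smult c d) n = 0" if "n \<ge> degree d" for n
  proof (cases "n = degree d")
    case True
    then show ?thesis using d(2) by (simp add: c_def)
  next
    case False
    with that obtain n' where "n = Suc n'" "n' \<ge> degree d"
      by (cases n) auto
    with False that sr(4) show ?thesis by (simp add: coeff_eq_0)
  qed
  moreover have "pCons a p = d * pCons c s + (pCons a r - smult c d)"
    by (simp add: sr(3))
  moreover have "pCons c s \<in> polys_over S" "pCons a r - smult c d \<in> polys_over S"
    using c sr(1) ar d(1) by (auto simp: polys_over_pCons polys_over_diff polys_over_smult)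
  ultimately show ?case by blast
qed

end

lemma polys_over_mono: "S \<subseteq> T \<Longrightarrow> polys_over S \<subseteq> polys_over T"
  by (auto simp: polys_over_def)

section \<open>Simple extensions, rational functions and linear dependence\<close>

definition adjoin :: "'a::field set \<Rightarrow> 'a \<Rightarrow> 'a set" where
  "adjoin S z = (\<lambda>p. poly p z) ` polys_over S"

lemma adjoin_subring:
  assumes S: "is_subring S"
  shows "is_subring (adjoin S z)"
  unfolding is_subring_def adjoin_def
proof (intro conjI ballI)
  show "0 \<in> (\<lambda>p. poly p z) ` polys_over S"
    by (rule image_eqI[of _ _ 0]) (auto simp: polys_over_0[OF S])
  show "1 \<in> (\<lambda>p. poly p z) ` polys_over S"
    by (rule image_eqI[of _ _ 1]) (auto simp: polys_over_1[OF S])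
qed (auto simp: polys_over_uminus[OF S] polys_over_add[OF S] polys_over_mult[OF S]
       simp flip: poly_add poly_mult poly_minus)

lemma adjoin_superset:
  assumes S: "is_subring S"
  shows "S \<subseteq> adjoin S z"
proof
  fix a assume "a \<in> S"
  then show "a \<in> adjoin S z"
    unfolding adjoin_def
    by (intro image_eqI[of _ _ "[:a:]"]) (auto simp: polys_over_pCons[OF S] polys_over_0[OF S])
qed

lemma adjoin_gen: "is_subring S \<Longrightarrow> z \<in> adjoin S z"
  by (auto simp: adjoin_def polys_over_pCons polys_over_0 subring_0 subring_1
      intro!: image_eqI[of _ _ "[:0, 1:]"])

lemma adjoin_least: "is_subring T \<Longrightarrow> S \<subseteq> T \<Longrightarrow> z \<in> T \<Longrightarrow> adjoin S z \<subseteq> T"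
  using polys_over_mono[of S T] poly_in_subring[of T] by (auto simp: adjoin_def)

definition ratfun :: "'a::field set \<Rightarrow> 'a \<Rightarrow> 'a set" where
  "ratfun K z = {poly p z / poly r z | p r. p \<in> polys_over K \<and> r \<in> polys_over K \<and> poly r z \<noteq> 0}"

lemma ratfun_subfield:
  assumes K: "is_subring K"
  shows "is_subfield (ratfun K z)"
  unfolding is_subfield_def is_subring_def
proof (intro conjI ballI)
  note in_ratfun = ratfun_def mem_Collect_eq
  show "0 \<in> ratfun K z"
    unfolding in_ratfun by (intro exI[of _ 0] exI[of _ 1]) (auto simp: polys_over_0[OF K] polys_over_1[OF K])
  show "1 \<in> ratfun K z"
    unfolding in_ratfun by (intro exI[of _ 1]) (auto simp: polys_over_1[OF K])
  fix a assume "a \<in> ratfun K z"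
  then obtain p r where a: "a = poly p z / poly r z" "p \<in> polys_over K" "r \<in> polys_over K" "poly r z \<noteq> 0"
    by (auto simp: ratfun_def)
  show "- a \<in> ratfun K z"
    unfolding in_ratfun using a by (intro exI[of _ "- p"] exI[of _ r]) (auto simp: polys_over_uminus[OF K])
  show "inverse a \<in> ratfun K z"
  proof (cases "poly p z = 0")
    case True
    then show ?thesis using a \<open>0 \<in> ratfun K z\<close> by simp
  next
    case False
    then show ?thesis
      unfolding in_ratfun using a by (intro exI[of _ r] exI[of _ p]) auto
  qed
  fix b assume "b \<in> ratfun K z"
  then obtain p' r' where b: "b = poly p' z / poly r' z" "p' \<in> polys_over K" "r' \<in> polys_over K" "poly r' z \<noteq> 0"
    by (auto simp: ratfun_def)
  show "a + b \<in> ratfun K z"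
    unfolding in_ratfun using a b
    by (intro exI[of _ "p * r' + p' * r"] exI[of _ "r * r'"])
      (auto simp: polys_over_add[OF K] polys_over_mult[OF K] add_frac_eq)
  show "a * b \<in> ratfun K z"
    unfolding in_ratfun using a b
    by (intro exI[of _ "p * p'"] exI[of _ "r * r'"]) (auto simp: polys_over_mult[OF K])
qed

lemma adjoin_subset_ratfun: "is_subring K \<Longrightarrow> adjoin K z \<subseteq> ratfun K z"
  unfolding adjoin_def ratfun_def
proof safe
  fix p assume "is_subring K" "p \<in> polys_over K"
  then show "\<exists>p' r. poly p z = poly p' z / poly r z \<and> p' \<in> polys_over K \<and> r \<in> polys_over K \<and> poly r z \<noteq> 0"
    by (intro exI[of _ p] exI[of _ 1]) (auto simp: polys_over_1)
qed

lemma ratfun_least: "is_subfield T \<Longrightarrow> K \<subseteq> T \<Longrightarrow> z \<in> T \<Longrightarrow> ratfun K z \<subseteq> T"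
  using polys_over_mono[of K T]
  by (auto simp: ratfun_def subfield_subring intro!: subfield_divide poly_in_subring)

lemma ratfun_inverse:
  assumes K: "is_subring K"
  shows "ratfun K (inverse z) = ratfun K z"
proof -
  have "ratfun K (inverse w) \<subseteq> ratfun K w" for w
    using ratfun_subfield[OF K, of w] adjoin_subset_ratfun[OF K, of w] adjoin_superset[OF K, of w]
      adjoin_gen[OF K, of w]
    by (intro ratfun_least) (auto simp: subfield_inverse)
  from this[of z] this[of "inverse z"] show ?thesis by auto
qed

text \<open>Gaussian elimination: with more unknowns \<open>I\<close> than equations
  \<open>J\<close> there is a nontrivial solution. The induction removes one equation
  \<open>j0\<close> together with one pivot unknown \<open>k0\<close>.\<close>

lemma linear_dependency:
  assumes L: "is_subfield L" and "finite J" "finite I" "card J < card I"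
    and "\<And>k j. k \<in> I \<Longrightarrow> j \<in> J \<Longrightarrow> c k j \<in> L"
  shows "\<exists>d. (\<forall>k\<in>I. d k \<in> L) \<and> (\<exists>k\<in>I. d k \<noteq> 0) \<and> (\<forall>j\<in>J. (\<Sum>k\<in>I. d k * c k j) = 0)"
  using assms(2-)
proof (induction J arbitrary: I c rule: finite_induct)
  case empty
  then have "I \<noteq> {}" by auto
  then show ?case
    by (intro exI[of _ "\<lambda>_. 1"]) (auto simp: subfield_subring[OF L] subring_1)
next
  case (insert j0 J)
  note Lr = subfield_subring[OF L]
  show ?case
  proof (cases "\<forall>k\<in>I. c k j0 = 0")
    case True
    have "card J < card I" using insert by simp
    with insert.IH[of I c] insert.prems True show ?thesis by auto
  next
    case False
    then obtain k0 where k0: "k0 \<in> I" "c k0 j0 \<noteq> 0" by auto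
    define I' where "I' = I - {k0}"
    define c' where "c' k j = c k j - c k j0 * (c k0 j / c k0 j0)" for k j
    have fin: "finite I'" and I: "I = insert k0 I'" "k0 \<notin> I'"
      using insert.prems k0 by (auto simp: I'_def)
    have "card J < card I'"
      using insert I fin by simp
    moreover have "c' k j \<in> L" if "k \<in> I'" "j \<in> J" for k j
      using that insert.prems(3) k0(1)
      by (auto simp: I c'_def intro!: subring_diff[OF Lr] subring_mult[OF Lr] subfield_divide[OF L])
    ultimately obtain d' where d': "\<forall>k\<in>I'. d' k \<in> L" "\<exists>k\<in>I'. d' k \<noteq> 0"
        "\<forall>j\<in>J. (\<Sum>k\<in>I'. d' k * c' k j) = 0"
      using insert.IH[of I' c'] fin by blast
    define e where "e = - (\<Sum>k\<in>I'. d' k * c k j0) / c k0 j0"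
    define d where "d = d'(k0 := e)"
    have dI: "(\<Sum>k\<in>I. d k * c k j) = e * c k0 j + (\<Sum>k\<in>I'. d' k * c k j)" for j
    proof -
      have "(\<Sum>k\<in>I'. d k * c k j) = (\<Sum>k\<in>I'. d' k * c k j)"
        using I(2) by (intro sum.cong) (auto simp: d_def)
      then show ?thesis using I fin by (simp add: d_def)
    qed
    have "e \<in> L"
      unfolding e_def using insert.prems(3) d'(1) k0(1)
      by (intro subfield_divide[OF L] subring_uminus[OF Lr] subring_sum[OF Lr] subring_mult[OF Lr]) (auto simp: I)
    then have "\<forall>k\<in>I. d k \<in> L"
      using d'(1) I by (auto simp: d_def)
    moreover have "\<exists>k\<in>I. d k \<noteq> 0"
      using d'(2) I by (auto simp: d_def)
    moreover have "(\<Sum>k\<in>I. d k * c k j0) = 0"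
      using k0 by (simp add: dI e_def)
    moreover have "(\<Sum>k\<in>I. d k * c k j) = 0" if "j \<in> J" for j
    proof -
      have "0 = (\<Sum>k\<in>I'. d' k * c' k j)"
        using d'(3) that by simp
      also have "\<dots> = (\<Sum>k\<in>I'. d' k * c k j) - (\<Sum>k\<in>I'. d' k * c k j0) * (c k0 j / c k0 j0)"
        by (simp add: c'_def algebra_simps sum_subtractf sum_distrib_left)
      finally show ?thesis
        by (simp add: dI e_def)
    qed
    ultimately show ?thesis by auto
  qed
qed

section \<open>Existence of valuation rings\<close>

definition nonunits :: "'a::field set \<Rightarrow> 'a set" where
  "nonunits R = {z \<in> R. z = 0 \<or> inverse z \<notin> R}"

lemma is_place_altdef: "is_place K P \<longleftrightarrow> (\<exists>R. valuation_ring K R \<and> P = nonunits R)"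
  by (simp add: is_place_def nonunits_def)

text \<open>Valuation rings with constants and properness left aside, so that Zorn's lemma can
  deliver one before a field of constants is considered.\<close>

locale total_subring =
  fixes R :: "'a::field set"
  assumes sub: "is_subring R" and total: "z \<in> R \<or> inverse z \<in> R"
begin

lemma one_notin_nonunits: "1 \<notin> nonunits R"
  by (simp add: nonunits_def subring_1[OF sub])

lemma nonunits_subset: "nonunits R \<subseteq> R"
  by (auto simp: nonunits_def)

lemma nonunits_mult:
  assumes "a \<in> nonunits R" "r \<in> R"
  shows "a * r \<in> nonunits R"
proof -
  have "a = 0 \<or> r = 0 \<or> inverse (a * r) \<notin> R"
  proof (rule ccontr)
    assume *: "\<not> ?thesis"
    then have "inverse (a * r) * r \<in> R"
      using assms(2) by (auto intro: subring_mult[OF sub])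
    then have "inverse a \<in> R" using * by (simp add: field_simps)
    with assms(1) * show False by (auto simp: nonunits_def)
  qed
  then show ?thesis
    using assms by (auto simp: nonunits_def subring_mult[OF sub] subring_0[OF sub])
qed

lemma nonunits_add:
  assumes "a \<in> nonunits R" "b \<in> nonunits R"
  shows "a + b \<in> nonunits R"
proof -
  have *: "a + b \<in> nonunits R" if "a \<in> nonunits R" "b \<in> nonunits R" "a \<noteq> 0" "b / a \<in> R" for a b
  proof -
    have "a * (1 + b / a) \<in> nonunits R"
      using that by (intro nonunits_mult subring_add[OF sub] subring_1[OF sub])
    then show ?thesis using that by (simp add: distrib_left)
  qed
  show ?thesis
  proof (cases "a = 0 \<or> b = 0")
    case False
    then have "b / a \<in> R \<or> a / b \<in> R"
      using total[of "b / a"] by simp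
    with False *[of a b] *[of b a] assms show ?thesis by (auto simp: add.commute)
  qed (use assms in auto)
qed

lemma nonunits_sum:
  "(\<And>k. k \<in> I \<Longrightarrow> g k \<in> nonunits R) \<Longrightarrow> sum g I \<in> nonunits R"
  by (induction I rule: infinite_finite_induct)
    (auto simp: nonunits_add, simp_all add: nonunits_def subring_0[OF sub])

lemma ring_at_nonunits: "ring_at (nonunits R) = R"
  using total by (auto simp: ring_at_def nonunits_def subring_0[OF sub])

lemma unitI: "a \<in> R \<Longrightarrow> a \<notin> nonunits R \<Longrightarrow> a \<noteq> 0 \<and> inverse a \<in> R"
  by (auto simp: nonunits_def)

text \<open>Were \<open>z\<close> outside \<open>R\<close>, then \<open>inverse z\<close> would be a
  nonunit; dividing the monic equation by \<open>z ^ n\<close> writes \<open>1\<close> as a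
  combination of positive powers of \<open>inverse z\<close>, making \<open>1\<close> a
  nonunit.\<close>

lemma integrally_closed:
  assumes p: "p \<in> polys_over R" "lead_coeff p = 1" "poly p z = 0"
  shows "z \<in> R"
proof (rule ccontr)
  assume z: "z \<notin> R"
  then have z0: "z \<noteq> 0" using subring_0[OF sub] by auto
  have iz: "inverse z \<in> nonunits R"
    using z total[of z] by (auto simp: nonunits_def)
  define n where "n = degree p"
  have "n \<noteq> 0"
  proof
    assume "n = 0"
    then obtain a where "p = [:a:]" by (auto simp: n_def elim: degree_eq_zeroE)
    with p show False by simp
  qed
  have "0 = poly p z / z ^ n" using p by simp
  also have "\<dots> = (\<Sum>k\<le>n. coeff p k * (z ^ k / z ^ n))"
    by (simp add: poly_altdef n_def sum_divide_distrib)
  also have "\<dots> = (\<Sum>k\<in>insert n {..<n}. coeff p k * (z ^ k / z ^ n))"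
    by (intro sum.cong) auto
  also have "\<dots> = 1 + (\<Sum>k<n. coeff p k * (z ^ k / z ^ n))"
    using p(2) z0 by (simp add: n_def)
  also have "(\<Sum>k<n. coeff p k * (z ^ k / z ^ n)) = (\<Sum>k<n. inverse z * (inverse z ^ (n - 1 - k) * coeff p k))"
  proof (intro sum.cong refl)
    fix k assume "k \<in> {..<n}"
    then have "z ^ n = z ^ k * (z ^ (n - 1 - k) * z)"
      by (simp flip: power_add power_Suc2 add: Suc_diff_Suc)
    then show "coeff p k * (z ^ k / z ^ n) = inverse z * (inverse z ^ (n - 1 - k) * coeff p k)"
      using z0 by (simp add: field_simps)
  qed
  finally have "1 = - (\<Sum>k<n. inverse z * (inverse z ^ (n - 1 - k) * coeff p k))"
    by (simp add: eq_neg_iff_add_eq_0)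
  also have "\<dots> = (\<Sum>k<n. inverse z * (inverse z ^ (n - 1 - k) * - coeff p k))"
    by (simp add: sum_negf)
  also have "\<dots> \<in> nonunits R"
    using p(1) iz nonunits_subset unfolding polys_over_def
    by (intro nonunits_sum nonunits_mult subring_mult[OF sub] subring_power[OF sub] subring_uminus[OF sub]) auto
  finally show False using one_notin_nonunits by simp
qed

lemma power_in_imp_in:
  assumes "n > 0" "z ^ n \<in> R"
  shows "z \<in> R"
proof (rule integrally_closed)
  show "monom 1 n + [:- (z ^ n):] \<in> polys_over R"
    using assms by (intro polys_over_add polys_over_monom)
       (auto simp: sub subring_uminus[OF sub] polys_over_pCons[OF sub] polys_over_0[OF sub] subring_1[OF sub])
  have "degree (monom 1 n + [:- (z ^ n):]) = n"
    using assms degree_add_eq_left[of "[:- (z ^ n):]" "monom (1::'a) n"]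
    by (simp add: degree_monom_eq )
  then show "lead_coeff (monom 1 n + [:- (z ^ n):]) = 1"
    using assms by (simp add: coeff_pCons split: nat.split)
qed (simp add: poly_monom)

text \<open>A relation over a field inside \<open>R\<close> becomes monic after scaling. Used to
  show that a proper valuation ring cannot contain all of \<open>K(z)\<close>.\<close>

lemma subset_if_algebraic:
  assumes L: "is_subfield L" "L \<subseteq> R" and a: "\<And>k. k \<le> n \<Longrightarrow> a k \<in> L" "\<exists>k\<le>n. a k \<noteq> 0"
    and rel: "(\<Sum>k\<le>n. a k * f ^ k) = 0"
  shows "f \<in> R"
proof -
  define p where "p = (\<Sum>k\<le>n. monom (a k) k)"
  have cp: "coeff p j = (if j \<le> n then a j else 0)" for j
    by (simp add: p_def coeff_sum)
  have pL: "p \<in> polys_over L"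
    using a by (auto simp: polys_over_def cp subring_0[OF subfield_subring[OF L(1)]])
  have "p \<noteq> 0"
    using a(2) cp by (metis coeff_0)
  then have lc: "lead_coeff p \<noteq> 0" by simp
  have "smult (inverse (lead_coeff p)) p \<in> polys_over R"
    using pL L polys_over_mono[OF L(2)]
    by (auto simp: polys_over_def subfield_inverse intro!: subring_mult[OF sub])
  moreover have "poly p f = 0"
    using rel by (simp add: p_def poly_sum poly_monom)
  ultimately show ?thesis
    using lc by (intro integrally_closed[of "smult (inverse (lead_coeff p)) p"]) auto
qed

text \<open>In a vanishing sum the terms of least valuation cannot be alone.\<close>

lemma vanishing_sum_associates:
  assumes "finite I" "(\<Sum>k\<in>I. T k) = 0" "\<And>k. k \<in> I \<Longrightarrow> T k \<noteq> 0" "I \<noteq> {}"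
  obtains j k where "j \<in> I" "k \<in> I" "j \<noteq> k" "T j / T k \<in> R" "T k / T j \<in> R"
proof -
  \<comment> \<open>\<open>T j\<close> is a term of least valuation; divisibility in
    \<open>R\<close> is total, so a finite family has one.\<close>
  have "\<exists>j\<in>I. \<forall>k\<in>I. T k / T j \<in> R"
    using assms(1,4,3)
  proof (induction I rule: finite_ne_induct)
    case (singleton j)
    then show ?case by (simp add: subring_1[OF sub])
  next
    case (insert j' I)
    then obtain j where j: "j \<in> I" "\<forall>k\<in>I. T k / T j \<in> R" by auto
    have nz: "T j \<noteq> 0" "T j' \<noteq> 0" using insert j by auto
    show ?case
    proof (cases "T j' / T j \<in> R")
      case True
      with j show ?thesis by auto
    next
      case False
      then have *: "T j / T j' \<in> R" using total[of "T j' / T j"] by simp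
      have "T k / T j' \<in> R" if "k \<in> I" for k
        using subring_mult[OF sub * bspec[OF j(2) that]] nz by (simp add: field_simps)
      then show ?thesis using nz subring_1[OF sub] by auto
    qed
  qed
  then obtain j where j: "j \<in> I" "\<And>k. k \<in> I \<Longrightarrow> T k / T j \<in> R" by auto
  have nz: "T j \<noteq> 0" using j assms by auto
  \<comment> \<open>Otherwise, after division by \<open>T j\<close>, the other terms would add up to
    \<open>- 1\<close> and make it a nonunit.\<close>
  have "\<exists>k\<in>I - {j}. T k / T j \<notin> nonunits R"
  proof (rule ccontr)
    assume "\<not> ?thesis"
    then have "(\<Sum>k\<in>I - {j}. T k / T j) \<in> nonunits R"
      by (intro nonunits_sum) auto
    moreover have "(\<Sum>k\<in>I. T k / T j) = 0"
      using assms(2) by (simp flip: sum_divide_distrib)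
    then have "(\<Sum>k\<in>I - {j}. T k / T j) = - 1"
      using nz j(1) assms(1) by (simp add: sum.remove eq_neg_iff_add_eq_0 add.commute)
    ultimately have "- 1 \<in> nonunits R" by simp
    then show False
      using nonunits_mult[of "- 1" "- 1"] one_notin_nonunits
      by (simp add: subring_uminus[OF sub] subring_1[OF sub])
  qed
  then obtain k where "k \<in> I" "k \<noteq> j" "T k / T j \<notin> nonunits R" by auto
  with unitI[OF j(2), of k] that[of j k] j show ?thesis by auto
qed

end

lemma valuation_ring_total: "valuation_ring K R \<Longrightarrow> total_subring R"
  by (auto simp: valuation_ring_def total_subring_def)

text \<open>A subring \<open>B\<close> maximal among those missing \<open>1/t\<close> works: \<open>1 - t b\<close> is a unit for every \<open>b \<in> B\<close>,
  so if \<open>z\<close> and \<open>1/z\<close> were both missing, the longer of two shortest relations \<open>1 = t p(z)\<close> and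
  \<open>1 = t r(1/z)\<close> could be shortened by means of the other.\<close>

lemma exists_total_subring:
  assumes A: "is_subring A" "t \<in> A" "inverse t \<notin> A"
  shows "\<exists>R. total_subring R \<and> A \<subseteq> R \<and> inverse t \<notin> R"
proof -
  define \<A> where "\<A> = {B. is_subring B \<and> A \<subseteq> B \<and> inverse t \<notin> B}"
  have "\<exists>M\<in>\<A>. \<forall>X\<in>\<A>. M \<subseteq> X \<longrightarrow> X = M"
  proof (rule subset_Zorn_nonempty)
    show "\<A> \<noteq> {}" using A by (auto simp: \<A>_def)
    fix \<C> assume C: "\<C> \<noteq> {}" "subset.chain \<A> \<C>"
    then have CA: "B \<in> \<A>" if "B \<in> \<C>" for B
      using that by (auto simp: subset_chain_def)
    have two: "\<exists>B\<in>\<C>. a \<in> B \<and> b \<in> B" if "a \<in> \<Union>\<C>" "b \<in> \<Union>\<C>" for a b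
      using that C(2) unfolding subset_chain_def by (metis UnionE subsetD)
    have "is_subring (\<Union>\<C>)"
      unfolding is_subring_def
    proof (intro conjI ballI)
      fix a b assume "a \<in> \<Union>\<C>" "b \<in> \<Union>\<C>"
      from two[OF this] CA show "a + b \<in> \<Union>\<C>" "a * b \<in> \<Union>\<C>"
        by (auto simp: \<A>_def intro: subring_add subring_mult)
    qed (use C(1) CA in \<open>auto simp: \<A>_def intro: subring_0 subring_1 subring_uminus\<close>)
    then show "\<Union>\<C> \<in> \<A>" using C(1) CA by (auto simp: \<A>_def)
  qed
  then obtain B where B: "is_subring B" "A \<subseteq> B" "inverse t \<notin> B"
    and max: "\<And>X. is_subring X \<Longrightarrow> B \<subseteq> X \<Longrightarrow> inverse t \<notin> X \<Longrightarrow> X = B"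
    unfolding \<A>_def by (smt (verit) mem_Collect_eq subset_trans)
  have tB: "t \<in> B" using A B by auto
  have t0: "t \<noteq> 0" using B(1,3) subring_0 by force
  \<comment> \<open>Maximality: adjoining any missing \<open>z\<close> must bring in
    \<open>inverse t\<close>.\<close>
  have adj: "\<exists>p\<in>polys_over B. inverse t = poly p z" if "z \<notin> B" for z
  proof (rule ccontr)
    assume "\<not> ?thesis"
    then have "inverse t \<notin> adjoin B z" by (auto simp: adjoin_def)
    then have "adjoin B z = B"
      using B(1) by (intro max adjoin_subring adjoin_superset)
    then show False using adjoin_gen[OF B(1), of z] that by simp
  qed
  have unit: "inverse (1 - t * b) \<in> B" if b: "b \<in> B" for b
  proof (rule ccontr)
    assume "\<not> ?thesis"
    then obtain p where p: "p \<in> polys_over B" "inverse t = poly p (inverse (1 - t * b))"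
      using adj by blast
    define s where "s = 1 - t * b"
    have s: "s \<in> B"
      using b tB by (simp add: s_def subring_diff subring_mult subring_1 B(1))
    have "s \<noteq> 0"
    proof
      assume "s = 0"
      then have "inverse t = b" using t0 by (simp add: s_def field_simps)
      with b B show False by simp
    qed
    \<comment> \<open>The power of \<open>s\<close> clears the denominators. Every
      \<open>s ^ n\<close> has the form \<open>1 - t * c\<close> with \<open>c\<close> in
      \<open>B\<close>, so \<open>s ^ n * inverse t\<close> differs from \<open>inverse t\<close> by
      an element of \<open>B\<close>.\<close>
    have "s ^ degree p * poly p (inverse s) \<in> B"
    proof -
      have "s ^ degree p * poly p (inverse s) = (\<Sum>k\<le>degree p. coeff p k * s ^ (degree p - k))"
        unfolding poly_altdef sum_distrib_left
      proof (intro sum.cong refl)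
        fix k assume "k \<in> {..degree p}"
        then have "s ^ degree p = s ^ k * s ^ (degree p - k)"
          by (simp flip: power_add)
        then show "s ^ degree p * (coeff p k * inverse s ^ k) = coeff p k * s ^ (degree p - k)"
          using \<open>s \<noteq> 0\<close> by (simp add: field_simps)
      qed
      also have "\<dots> \<in> B"
        using p(1) s by (auto simp: polys_over_def intro!: subring_sum subring_mult subring_power B(1))
      finally show ?thesis .
    qed
    then have "s ^ degree p * inverse t \<in> B" using p(2) by (simp add: s_def)
    moreover have "\<exists>c\<in>B. s ^ n = 1 - t * c" for n
    proof (induction n)
      case 0
      show ?case using subring_0[OF B(1)] by (intro bexI[of _ 0]) auto
    next
      case (Suc n)
      then obtain c where c: "c \<in> B" "s ^ n = 1 - t * c" by auto
      have "s ^ Suc n = (1 - t * b) * (1 - t * c)"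
        unfolding power_Suc c(2) by (simp add: s_def)
      then have "s ^ Suc n = 1 - t * (b + c - b * t * c)"
        by (simp add: algebra_simps)
      moreover have "b + c - b * t * c \<in> B"
        using b c tB by (intro subring_diff subring_add subring_mult B(1))
      ultimately show ?case by blast
    qed
    then obtain c where c: "c \<in> B" "s ^ degree p = 1 - t * c" by blast
    ultimately have "s ^ degree p * inverse t + c \<in> B"
      by (simp add: subring_add B(1))
    also have "s ^ degree p * inverse t + c = inverse t"
      using c t0 by (simp add: field_simps)
    finally show False using B by simp
  qed
  have "z \<in> B \<or> inverse z \<in> B" for z
  proof (rule ccontr)
    assume z: "\<not> ?thesis"
    define Q where "Q w n \<longleftrightarrow> (\<exists>p\<in>polys_over B. degree p \<le> n \<and> 1 = t * poly p w)" for w n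
    have ex: "\<exists>n. Q w n" if "w \<notin> B" for w
      using adj[OF that] t0 unfolding Q_def by (metis order_refl right_inverse)
    have step: False if w: "w \<noteq> 0" "Q w n" "Q (inverse w) k" "k \<le> n" "\<And>l. Q w l \<Longrightarrow> n \<le> l" "n > 0" for w n k
    proof -
      from w(2) obtain p where p: "p \<in> polys_over B" "degree p \<le> n" "1 = t * poly p w"
        by (auto simp: Q_def)
      from w(3) obtain r where r: "r \<in> polys_over B" "degree r \<le> k" "1 = t * poly r (inverse w)"
        by (auto simp: Q_def)
      define c where "c = coeff p n"
      define e where "e = inverse (1 - t * coeff r 0)"
      have cB: "c \<in> B" using p by (auto simp: c_def polys_over_def)
      have eB: "e \<in> B" using unit r(1) by (simp add: e_def polys_over_def)
      have nz: "1 - t * coeff r 0 \<noteq> 0"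
      proof
        assume "1 - t * coeff r 0 = 0"
        then have "inverse t = coeff r 0" using t0 by (simp add: field_simps)
        then show False using r(1) B(3) by (simp add: polys_over_def)
      qed
      have "1 = t * (\<Sum>j\<le>k. coeff r j * inverse w ^ j)"
        by (subst r(3), subst poly_altdef, intro arg_cong2[of _ _ _ _ "(*)"] refl sum.mono_neutral_left)
          (use r(2) in \<open>auto simp: coeff_eq_0\<close>)
      also have "{..k} = insert 0 {1..k}" by auto
      finally have "1 - t * coeff r 0 = t * (\<Sum>j\<in>{1..k}. coeff r j * inverse w ^ j)"
        by (simp add: algebra_simps)
      then have "w ^ n * (1 - t * coeff r 0) = t * (\<Sum>j\<in>{1..k}. coeff r j * (w ^ n * inverse w ^ j))"
        by (simp add: sum_distrib_left mult_ac)
      also have "(\<Sum>j\<in>{1..k}. coeff r j * (w ^ n * inverse w ^ j)) = (\<Sum>j\<in>{1..k}. coeff r j * w ^ (n - j))"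
        using w(1,4) by (intro sum.cong refl) (auto simp: power_diff field_simps)
      finally have "w ^ n * (1 - t * coeff r 0) = t * (\<Sum>j\<in>{1..k}. coeff r j * w ^ (n - j))" .
      \<comment> \<open>The relation for \<open>inverse w\<close> times \<open>w ^ n\<close>, its
        constant term moved to the left and divided by the unit \<open>1 - t * coeff r 0\<close>,
        expresses \<open>w ^ n\<close> by lower powers; \<open>k <= n\<close> keeps the exponents
        nonnegative.\<close>
      then have wn: "w ^ n = t * (\<Sum>j\<in>{1..k}. e * coeff r j * w ^ (n - j))"
      proof -
        assume "w ^ n * (1 - t * coeff r 0) = t * (\<Sum>j\<in>{1..k}. coeff r j * w ^ (n - j))"
        then have "w ^ n = e * (t * (\<Sum>j\<in>{1..k}. coeff r j * w ^ (n - j)))"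
          using nz by (simp add: e_def eq_divide_eq flip: divide_inverse_commute)
        then show ?thesis by (simp add: sum_distrib_left mult_ac)
      qed
      \<comment> \<open>The term \<open>c * w ^ n\<close> is replaced by that expression, which
        lowers the degree bound without changing the value at \<open>w\<close>.\<close>
      define p' where "p' = (p - monom c n) + (\<Sum>j\<in>{1..k}. monom (t * c * e * coeff r j) (n - j))"
      have "p' \<in> polys_over B"
        unfolding p'_def using p r cB eB tB
        by (intro polys_over_add polys_over_diff polys_over_monom polys_over_sum subring_mult B(1))
          (auto simp: polys_over_def)
      moreover have "degree p' \<le> n - 1"
      proof (rule degree_le, safe)
        fix l assume l: "n - 1 < l"
        have "coeff (p - monom c n) l = 0"
          using l p(2) by (cases "l = n") (auto simp: c_def coeff_eq_0)
        moreover have "(\<Sum>j\<in>{1..k}. coeff (monom (t * c * e * coeff r j) (n - j)) l) = 0"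
          using l by (intro sum.neutral) auto
        ultimately show "coeff p' l = 0" by (simp add: p'_def coeff_sum)
      qed
      moreover have "poly p' w = poly p w"
        by (simp add: p'_def poly_sum poly_monom wn sum_distrib_left mult_ac)
      ultimately have "Q w (n - 1)" unfolding Q_def using p by auto
      with w show False by force
    qed
    have no0: "\<not> Q w 0" for w
    proof
      assume "Q w 0"
      then obtain p where p: "p \<in> polys_over B" "degree p = 0" "1 = t * poly p w"
        by (auto simp: Q_def)
      then obtain a where "p = [:a:]" by (auto elim: degree_eq_zeroE)
      with p have "inverse t = a" "a \<in> B" using t0 by (auto simp: polys_over_pCons[OF B(1)] field_simps)
      with B show False by simp
    qed
    define n where "n = (LEAST n. Q z n)"
    define k where "k = (LEAST n. Q (inverse z) n)"
    have n: "Q z n" "\<And>l. Q z l \<Longrightarrow> n \<le> l" "n > 0"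
      using ex[of z] z no0 unfolding n_def by (auto intro: LeastI Least_le intro!: gr0I) (metis LeastI)
    have k: "Q (inverse z) k" "\<And>l. Q (inverse z) l \<Longrightarrow> k \<le> l" "k > 0"
      using ex[of "inverse z"] z no0 unfolding k_def by (auto intro: LeastI Least_le intro!: gr0I) (metis LeastI)
    have "z \<noteq> 0" using z subring_0[OF B(1)] by auto
    then show False
      using step[of z n k] step[of "inverse z" k n] n k by (cases "k \<le> n") auto
  qed
  with B show ?thesis by (auto simp: total_subring_def)
qed

text \<open>A form of Chevalley's extension theorem. The element \<open>t\<close> supplies both
  strict inclusions: it lies in \<open>R\<close> but not in \<open>K\<close>, and its inverse is
  missing from \<open>R\<close>.\<close>

lemma exists_valuation_ring:
  assumes K: "is_subfield K" and A: "is_subring A" "K \<subseteq> A" "t \<in> A" "inverse t \<notin> A"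
  shows "\<exists>R. valuation_ring K R \<and> A \<subseteq> R \<and> inverse t \<notin> R"
proof -
  obtain R where R: "total_subring R" "A \<subseteq> R" "inverse t \<notin> R"
    using exists_total_subring[OF A(1,3,4)] by auto
  have "t \<notin> K" using subfield_inverse[OF K] A by auto
  with R A have "valuation_ring K R"
    by (auto simp: valuation_ring_def total_subring_def)
  with R show ?thesis by auto
qed

section \<open>Discrete valuations\<close>

definition runits :: "'a::field set \<Rightarrow> 'a set" where
  "runits R = {u \<in> R. u \<noteq> 0 \<and> inverse u \<in> R}"

context total_subring
begin

lemma runits_1: "1 \<in> runits R"
  by (simp add: runits_def subring_1[OF sub])

lemma runits_mult: "u \<in> runits R \<Longrightarrow> w \<in> runits R \<Longrightarrow> u * w \<in> runits R"
  by (simp add: runits_def subring_mult[OF sub])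

lemma runits_inverse: "u \<in> runits R \<Longrightarrow> inverse u \<in> runits R"
  by (simp add: runits_def)

lemma runits_divide: "u \<in> runits R \<Longrightarrow> w \<in> runits R \<Longrightarrow> u / w \<in> runits R"
  by (simp add: divide_inverse runits_mult runits_inverse)

lemma runits_power: "u \<in> runits R \<Longrightarrow> u ^ n \<in> runits R"
  by (induction n) (auto simp: runits_1 runits_mult)

lemma runits_iff: "u \<in> runits R \<longleftrightarrow> u \<in> R - nonunits R"
  by (auto simp: runits_def nonunits_def)

lemma powi_in_iff:
  assumes pi: "\<pi> \<in> nonunits R" "\<pi> \<noteq> 0"
  shows "\<pi> powi n \<in> R \<longleftrightarrow> n \<ge> 0"
proof
  assume *: "\<pi> powi n \<in> R"
  show "n \<ge> 0"
  proof (rule ccontr)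
    assume "\<not> n \<ge> 0"
    define l where "l = nat (- 1 - n)"
    with \<open>\<not> n \<ge> 0\<close> have l: "n = - 1 - int l" by simp
    have "\<pi> ^ l * \<pi> powi n \<in> R"
      using * pi(1) nonunits_subset by (intro subring_mult[OF sub] subring_power[OF sub]) auto
    also have "\<pi> ^ l * \<pi> powi n = inverse \<pi>"
      using pi(2) by (simp add: l power_int_diff power_int_minus field_simps)
    finally show False using pi by (simp add: nonunits_def)
  qed
next
  assume "n \<ge> 0"
  then show "\<pi> powi n \<in> R"
    using pi(1) nonunits_subset by (auto simp: power_int_def intro!: subring_power[OF sub])
qed

end

text \<open>The triangle inequality is encoded in \<open>in_iff\<close> together with the closure of
  \<open>R\<close> under addition; \<open>uniformizer\<close> normalises the value group to all
  integers; the value at \<open>0\<close> is arbitrary.\<close>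

locale discrete_valuation =
  fixes R :: "'a::field set" and v :: "'a \<Rightarrow> int"
  assumes sub: "is_subring R"
    and v_mult: "f \<noteq> 0 \<Longrightarrow> g \<noteq> 0 \<Longrightarrow> v (f * g) = v f + v g"
    and uniformizer: "\<exists>t. t \<noteq> 0 \<and> v t = 1"
    and in_iff: "f \<noteq> 0 \<Longrightarrow> f \<in> R \<longleftrightarrow> v f \<ge> 0"
begin

lemma v_1: "v 1 = 0"
  using v_mult[of 1 1] by simp

lemma v_inverse: "f \<noteq> 0 \<Longrightarrow> v (inverse f) = - v f"
  using v_mult[of f "inverse f"] by (simp add: v_1)

lemma v_divide: "f \<noteq> 0 \<Longrightarrow> g \<noteq> 0 \<Longrightarrow> v (f / g) = v f - v g"
  by (simp add: divide_inverse v_mult v_inverse)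

lemma v_power: "f \<noteq> 0 \<Longrightarrow> v (f ^ n) = int n * v f"
  by (induction n) (auto simp: v_1 v_mult algebra_simps)

lemma v_powi: "f \<noteq> 0 \<Longrightarrow> v (f powi n) = n * v f"
  by (auto simp: power_int_def v_power v_inverse)

sublocale total_subring R
proof
  show "z \<in> R \<or> inverse z \<in> R" for z
    using subring_0[OF sub] by (cases "z = 0") (auto simp: in_iff v_inverse)
qed (rule sub)

lemma nonunits_v: "f \<noteq> 0 \<Longrightarrow> f \<in> nonunits R \<longleftrightarrow> v f > 0"
  by (auto simp: nonunits_def in_iff v_inverse)

lemma runits_v: "f \<in> runits R \<longleftrightarrow> f \<noteq> 0 \<and> v f = 0"
  by (auto simp: runits_def in_iff v_inverse)

lemma v_add_distinct:
  assumes "a \<noteq> 0" "b \<noteq> 0" "v a < v b"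
  shows "a + b \<noteq> 0 \<and> v (a + b) = v a"
proof -
  have "b / a \<in> nonunits R"
    using assms by (simp add: nonunits_v v_divide)
  then have "1 + b / a \<in> R" "1 + b / a \<notin> nonunits R"
    using nonunits_subset nonunits_add[of "1 + b / a" "- (b / a)"] one_notin_nonunits
      nonunits_mult[of "b / a" "- 1"]
    by (auto simp: subring_add[OF sub] subring_1[OF sub] subring_uminus[OF sub])
  then have *: "1 + b / a \<noteq> 0" "v (1 + b / a) = 0"
    using runits_v[of "1 + b / a"] by (auto simp: runits_iff)
  have "a + b = a * (1 + b / a)" using assms by (simp add: field_simps)
  with * assms show ?thesis by (simp add: v_mult del: distrib_left)
qed

lemma v_sum_distinct:
  assumes "finite J" "J \<noteq> {}" "\<And>j. j \<in> J \<Longrightarrow> T j \<noteq> 0" "inj_on (\<lambda>j. v (T j)) J"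
  shows "\<exists>j\<in>J. sum T J \<noteq> 0 \<and> v (sum T J) = v (T j) \<and> (\<forall>k\<in>J. v (T j) \<le> v (T k))"
  using assms
proof (induction J rule: finite_ne_induct)
  case (insert j0 J)
  then obtain j where j: "j \<in> J" "sum T J \<noteq> 0" "v (sum T J) = v (T j)" "\<forall>k\<in>J. v (T j) \<le> v (T k)"
    by auto
  have "v (T j0) \<noteq> v (T j)"
    using insert.prems(2) insert.hyps j(1) by (auto simp: inj_on_def)
  then consider "v (T j0) < v (T j)" | "v (T j) < v (T j0)" by linarith
  then show ?case
  proof cases
    case 1
    then have "T j0 + sum T J \<noteq> 0 \<and> v (T j0 + sum T J) = v (T j0)"
      using j insert.prems(1)[of j0] by (intro v_add_distinct) auto
    with 1 j insert.hyps show ?thesis by force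
  next
    case 2
    then have "sum T J + T j0 \<noteq> 0 \<and> v (sum T J + T j0) = v (T j)"
      using j insert.prems(1)[of j0] v_add_distinct[of "sum T J" "T j0"] by auto
    with 2 j insert.hyps show ?thesis by (intro bexI[of _ j]) (auto simp: add.commute)
  qed
qed auto

text \<open>Links the description \<open>val_at\<close> to \<open>v\<close>. Uniqueness holds
  because any generator \<open>t\<close> of the maximal ideal divides an element of value
  \<open>1\<close>, hence has \<open>v t = 1\<close>.\<close>

lemma val_at_eq:
  assumes "f \<noteq> 0"
  shows "val_at (nonunits R) f = v f"
  unfolding val_at_def ring_at_nonunits
proof (rule the_equality)
  obtain t where t: "t \<noteq> 0" "v t = 1" using uniformizer by auto
  have "nonunits R = (\<lambda>a. t * a) ` R"
  proof (intro set_eqI iffI)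
    fix f assume f: "f \<in> nonunits R"
    show "f \<in> (\<lambda>a. t * a) ` R"
    proof (cases "f = 0")
      case False
      then have "f / t \<in> R" using f t by (simp add: nonunits_v in_iff v_divide)
      then show ?thesis using t by (intro image_eqI[of _ _ "f / t"]) auto
    qed (use subring_0[OF sub] in auto)
  next
    fix f assume "f \<in> (\<lambda>a. t * a) ` R"
    then show "f \<in> nonunits R"
      using t nonunits_mult[of t] by (auto simp: nonunits_v)
  qed
  moreover have "f / t powi v f \<in> R - nonunits R"
    using assms t by (auto simp: in_iff nonunits_v v_divide v_powi)
  ultimately show "\<exists>t u. nonunits R = (\<lambda>a. t * a) ` R \<and> u \<in> R - nonunits R \<and> f = t powi v f * u"
    using t by (intro exI[of _ t] exI[of _ "f / t powi v f"]) auto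
next
  fix n assume "\<exists>t u. nonunits R = (\<lambda>a. t * a) ` R \<and> u \<in> R - nonunits R \<and> f = t powi n * u"
  then obtain t u where tu: "nonunits R = (\<lambda>a. t * a) ` R" "u \<in> R - nonunits R" "f = t powi n * u"
    by auto
  obtain t1 where t1: "t1 \<noteq> 0" "v t1 = 1" using uniformizer by auto
  then have "t1 \<in> nonunits R" by (simp add: nonunits_v)
  then obtain a where a: "a \<in> R" "t1 = t * a" using tu(1) by auto
  then have nz: "t \<noteq> 0" "a \<noteq> 0" using t1 by auto
  have "t \<in> nonunits R"
    unfolding tu(1) by (rule image_eqI[of _ _ 1]) (auto simp: subring_1[OF sub])
  then have "v t > 0" "v a \<ge> 0" "v t + v a = 1"
    using nz a t1 v_mult[of t a] by (auto simp: nonunits_v in_iff)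
  then have "v t = 1" by linarith
  moreover have "u \<noteq> 0" "v u = 0"
    using tu(2) runits_v[of u] by (simp_all add: runits_iff)
  ultimately show "n = v f"
    using tu(3) nz by (simp add: v_mult v_powi)
qed

end

text \<open>The exponent \<open>w f\<close> for which \<open>f ^ N\<close> is associated to
  \<open>\<pi> powi w f\<close> is unique since \<open>\<pi>\<close> is a nonunit, so
  \<open>w\<close> is a homomorphism on the nonzero elements. It is a rescaled valuation with
  \<open>w \<pi> = N\<close>; dividing by the positive generator \<open>d\<close> of its image gives
  \<open>v\<close>.\<close>

lemma (in total_subring) discrete_valuation_if_power_associates:
  assumes pi: "\<pi> \<in> nonunits R" "\<pi> \<noteq> 0" and N: "N > 0"
    and assoc: "\<And>f. f \<noteq> 0 \<Longrightarrow> \<exists>n::int. f ^ N / \<pi> powi n \<in> runits R"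
  shows "\<exists>v. discrete_valuation R v"
proof -
  define w where "w f = (SOME n::int. f ^ N / \<pi> powi n \<in> runits R)" for f
  have w: "f ^ N / \<pi> powi w f \<in> runits R" if "f \<noteq> 0" for f
    unfolding w_def using assoc[OF that] by (rule someI_ex)
  have pi_unit: "n = 0" if "\<pi> powi n \<in> runits R" for n
  proof -
    have "\<pi> powi n \<in> R" "\<pi> powi (- n) \<in> R"
      using that by (auto simp: runits_def power_int_minus)
    then show ?thesis using powi_in_iff[OF pi] by force
  qed
  have w_eq: "w f = n" if "f \<noteq> 0" "f ^ N / \<pi> powi n \<in> runits R" for f n
  proof -
    have "\<pi> powi (w f - n) \<in> runits R"
      using runits_divide[OF that(2) w[OF that(1)]] pi(2) that(1) by (simp add: power_int_diff)
    then show ?thesis using pi_unit by force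
  qed
  have w_mult: "w (f * g) = w f + w g" if "f \<noteq> 0" "g \<noteq> 0" for f g
    using runits_mult[OF w[OF that(1)] w[OF that(2)]] that pi(2)
    by (intro w_eq) (auto simp: power_mult_distrib power_int_add)
  have w_in: "f \<in> R \<longleftrightarrow> w f \<ge> 0" if "f \<noteq> 0" for f
  proof -
    have u: "f ^ N / \<pi> powi w f \<in> R" "inverse (f ^ N / \<pi> powi w f) \<in> R"
      using w[OF that] by (auto simp: runits_def)
    have "f \<in> R \<longleftrightarrow> f ^ N \<in> R"
      using N subring_power[OF sub] power_in_imp_in by blast
    also have "\<dots> \<longleftrightarrow> \<pi> powi w f \<in> R"
      using subring_mult[OF sub u(1), of "\<pi> powi w f"] subring_mult[OF sub u(2), of "f ^ N"] that pi(2)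
      by (auto simp: field_simps)
    also have "\<dots> \<longleftrightarrow> w f \<ge> 0" by (rule powi_in_iff[OF pi])
    finally show ?thesis .
  qed
  have w_inv: "w (inverse f) = - w f" if "f \<noteq> 0" for f
    using w_mult[of f "inverse f"] w_mult[of 1 1] that by simp
  have w_power: "w (f ^ n) = int n * w f" if "f \<noteq> 0" for f n
    using that w_mult[of 1 1] by (induction n) (auto simp: w_mult algebra_simps)
  have w_powi: "w (f powi n) = n * w f" if "f \<noteq> 0" for f n
    using that by (auto simp: power_int_def w_power w_inv)
  have "w \<pi> = int N"
    using pi(2) runits_1 by (intro w_eq) auto
  define D where "D d \<longleftrightarrow> d > 0 \<and> (\<exists>f. f \<noteq> 0 \<and> w f = int d)" for d
  have "D N" using N pi(2) \<open>w \<pi> = int N\<close> by (auto simp: D_def)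
  define d where "d = (LEAST d. D d)"
  have "D d" unfolding d_def using \<open>D N\<close> by (rule LeastI)
  then obtain f0 where f0: "f0 \<noteq> 0" "w f0 = int d" "d > 0" by (auto simp: D_def)
  have dvd: "int d dvd w f" if "f \<noteq> 0" for f
  proof (rule ccontr)
    assume "\<not> ?thesis"
    then have "w f mod int d \<noteq> 0" by (simp add: dvd_eq_mod_eq_0)
    then have *: "0 < w f mod int d" "w f mod int d < int d"
      using f0(3) pos_mod_sign[of "int d" "w f"] pos_mod_bound[of "int d" "w f"] by linarith+
    define g where "g = f * f0 powi (- (w f div int d))"
    have "w g = w f - (w f div int d) * int d"
      using that f0 by (simp add: g_def w_mult w_powi)
    then have "w g = w f mod int d" by (simp add: minus_div_mult_eq_mod)
    with * that f0 have "D (nat (w f mod int d))" by (auto simp: D_def g_def intro!: exI[of _ g])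
    then have "d \<le> nat (w f mod int d)" unfolding d_def by (rule Least_le)
    with * show False by linarith
  qed
  define v where "v f = w f div int d" for f
  have wv: "w f = int d * v f" if "f \<noteq> 0" for f
    using dvd[OF that] by (simp add: v_def)
  have "discrete_valuation R v"
  proof
    fix f g :: 'a assume "f \<noteq> 0" "g \<noteq> 0"
    then have "int d * v (f * g) = int d * (v f + v g)"
      by (simp add: distrib_left w_mult flip: wv)
    then show "v (f * g) = v f + v g" using f0(3) by simp
  next
    have "int d * v f0 = int d" using wv[OF f0(1)] f0(2) by simp
    then have "v f0 = 1" using f0(3) by simp
    then show "\<exists>t. t \<noteq> 0 \<and> v t = 1" using f0 by auto
  next
    fix f :: 'a assume "f \<noteq> 0"
    then show "f \<in> R \<longleftrightarrow> v f \<ge> 0"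
      using f0(3) by (simp add: w_in wv zero_le_mult_iff)
  qed (rule sub)
  then show ?thesis by auto
qed

text \<open>The nonunits among the polynomials in \<open>z\<close> are the multiples of the one of least degree;
  bounded algebraicity then makes some fixed power of every element an associate of a power of it.\<close>

lemma (in total_subring) discrete_valuation_if_algebraic:
  assumes K: "is_subfield K" "K \<subseteq> R" and z: "z \<in> R" and proper: "R \<noteq> UNIV"
    and alg: "\<And>f. \<exists>a. (\<forall>k\<le>m. a k \<in> ratfun K z) \<and> (\<exists>k\<le>m. a k \<noteq> 0) \<and> (\<Sum>k\<le>m. a k * f ^ k) = 0"
  shows "\<exists>v. discrete_valuation R v"
proof -
  note Kr = subfield_subring[OF K(1)]
  have pR: "poly p z \<in> R" if "p \<in> polys_over K" for p
    using that polys_over_mono[OF K(2)] z by (intro poly_in_subring[OF sub]) auto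
  define N where "N p \<longleftrightarrow> p \<in> polys_over K \<and> poly p z \<in> nonunits R \<and> poly p z \<noteq> 0" for p
  \<comment> \<open>Otherwise all nonzero polynomials in \<open>z\<close> are units, so
    \<open>K(z)\<close> lies in \<open>R\<close>, and with it every element algebraic over
    \<open>K(z)\<close>.\<close>
  have "\<exists>p. N p"
  proof (rule ccontr)
    assume no: "\<not> ?thesis"
    have "ratfun K z \<subseteq> R"
    proof
      fix h assume "h \<in> ratfun K z"
      then obtain p r where h: "h = poly p z / poly r z" "p \<in> polys_over K" "r \<in> polys_over K" "poly r z \<noteq> 0"
        by (auto simp: ratfun_def)
      have "inverse (poly r z) \<in> R"
        using no h pR unitI[of "poly r z"] by (auto simp: N_def)
      then show "h \<in> R" using pR[OF h(2)] h(1) by (simp add: divide_inverse subring_mult[OF sub])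
    qed
    then have "f \<in> R" for f
      using subset_if_algebraic[OF ratfun_subfield[OF Kr]] alg[of f] by (metis (no_types, lifting))
    with proper show False by auto
  qed
  then obtain p1 where p1: "N p1" "\<And>p. N p \<Longrightarrow> degree p1 \<le> degree p"
    using exists_least_iff[of "\<lambda>n. \<exists>p. N p \<and> degree p = n"] by (metis not_le)
  define c where "c = inverse (lead_coeff p1)"
  have c: "c \<in> K" "c \<noteq> 0"
    using p1(1) subfield_inverse[OF K(1)] by (auto simp: N_def polys_over_def c_def)
  define p0 where "p0 = smult c p1"
  have "N p0"
    unfolding N_def
  proof (intro conjI)
    show "poly p0 z \<in> nonunits R"
      using nonunits_mult[of "poly p1 z" c] p1(1) c K(2) by (auto simp: N_def p0_def mult.commute)
  qed (use c p1(1) in \<open>auto simp: N_def p0_def polys_over_smult[OF Kr]\<close>)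
  have p0: "lead_coeff p0 = 1" "p0 \<in> polys_over K" "degree p0 = degree p1"
    using c p1(1) \<open>N p0\<close> by (auto simp: p0_def c_def N_def)
  define \<pi> where "\<pi> = poly p0 z"
  have pi: "\<pi> \<in> nonunits R" "\<pi> \<noteq> 0" using \<open>N p0\<close> by (auto simp: N_def \<pi>_def)
  have deg: "degree p0 > 0"
  proof (rule gr0I)
    assume "degree p0 = 0"
    then have "p0 = 1" using p0(1) by (metis degree_eq_zeroE lead_coeff_pCons(2) one_pCons)
    then show False using pi one_notin_nonunits by (simp add: \<pi>_def)
  qed
  have poly_assoc: "\<exists>n::nat. poly p z / \<pi> ^ n \<in> runits R" if "p \<in> polys_over K" "poly p z \<noteq> 0" for p
    using that
  proof (induction "degree p" arbitrary: p rule: less_induct)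
    case less
    obtain s r where sr: "s \<in> polys_over K" "r \<in> polys_over K" "p = p0 * s + r"
        "\<forall>n\<ge>degree p0. coeff r n = 0"
      using polys_over_division[OF Kr p0(2,1) less.prems(1)] by auto
    have degr: "degree r < degree p0"
      using sr(4) deg by (metis leading_coeff_0_iff degree_0 not_le)
    show ?case
    proof (cases "poly r z = 0")
      case True
      then have eq: "poly p z = \<pi> * poly s z" using sr(3) by (simp add: \<pi>_def)
      with less.prems have sz: "poly s z \<noteq> 0" by auto
      then have "degree (p0 * s) = degree p0 + degree s"
        using deg by (intro degree_mult_eq) auto
      with degr have "degree p = degree p0 + degree s"
        unfolding sr(3) by (subst degree_add_eq_left) auto
      with deg less.hyps[of s] sr(1) sz obtain n where "poly s z / \<pi> ^ n \<in> runits R" by auto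
      then show ?thesis using eq pi by (intro exI[of _ "Suc n"]) simp
    next
      case False
      \<comment> \<open>By minimality of the degree the nonzero value of the remainder is a unit,
        hence so is \<open>poly p z\<close>.\<close>
      then have "\<not> N r" using p1(2)[of r] degr p0(3) by auto
      then have r: "poly r z \<notin> nonunits R" using False sr(2) by (simp add: N_def)
      have "poly p z \<notin> nonunits R"
      proof
        assume "poly p z \<in> nonunits R"
        moreover have "\<pi> * - poly s z \<in> nonunits R"
          using pi pR[OF sr(1)] by (intro nonunits_mult subring_uminus[OF sub]) auto
        ultimately have "poly p z + \<pi> * - poly s z \<in> nonunits R" by (rule nonunits_add)
        then show False using r sr(3) by (simp add: \<pi>_def)
      qed
      then show ?thesis using pR[OF less.prems(1)] by (intro exI[of _ 0]) (auto simp: runits_iff)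
    qed
  qed
  have rat_assoc: "\<exists>n::int. h / \<pi> powi n \<in> runits R" if "h \<in> ratfun K z" "h \<noteq> 0" for h
  proof -
    from that(1) obtain p r where h: "h = poly p z / poly r z" "p \<in> polys_over K" "r \<in> polys_over K" "poly r z \<noteq> 0"
      by (auto simp: ratfun_def)
    with that obtain n n' where "poly p z / \<pi> ^ n \<in> runits R" "poly r z / \<pi> ^ n' \<in> runits R"
      using poly_assoc[of p] poly_assoc[of r] by auto
    from runits_divide[OF this] h(1) pi(2) show ?thesis
      by (intro exI[of _ "int n - int n'"]) (simp add: power_int_diff mult.commute)
  qed
  \<comment> \<open>Two associated terms of the relation make \<open>f ^ d\<close> an associate of a
    power of \<open>\<pi>\<close> for some positive \<open>d <= m\<close> depending on
    \<open>f\<close>; every such \<open>d\<close> divides \<open>m!\<close>, which makes the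
    exponent uniform.\<close>
  have "\<exists>n::int. f ^ fact m / \<pi> powi n \<in> runits R" if f: "f \<noteq> 0" for f
  proof -
    obtain a where a: "\<forall>k\<le>m. a k \<in> ratfun K z" "\<exists>k\<le>m. a k \<noteq> 0" "(\<Sum>k\<le>m. a k * f ^ k) = 0"
      using alg[of f] by auto
    define I where "I = {k. k \<le> m \<and> a k \<noteq> 0}"
    have "(\<Sum>k\<in>I. a k * f ^ k) = (\<Sum>k\<le>m. a k * f ^ k)"
      by (intro sum.mono_neutral_left) (auto simp: I_def)
    then have sum0: "(\<Sum>k\<in>I. a k * f ^ k) = 0" using a by simp
    obtain j k where jk: "j \<in> I" "k \<in> I" "j \<noteq> k" "(a j * f ^ j) / (a k * f ^ k) \<in> R" "(a k * f ^ k) / (a j * f ^ j) \<in> R"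
      using vanishing_sum_associates[OF _ sum0] a(2) f by (auto simp: I_def)
    have "\<exists>n::int. f ^ fact m / \<pi> powi n \<in> runits R"
      if jk: "j \<in> I" "k \<in> I" "k < j" "(a j * f ^ j) / (a k * f ^ k) \<in> R" "(a k * f ^ k) / (a j * f ^ j) \<in> R" for j k
    proof -
      have nz: "a j \<noteq> 0" "a k \<noteq> 0" using jk by (auto simp: I_def)
      define d where "d = j - k"
      have d: "d > 0" "d \<le> m" "j = d + k" using jk by (auto simp: d_def I_def)
      have u: "a j / a k * f ^ d \<in> runits R"
        using jk(4,5) nz f by (simp add: runits_def d(3) power_add field_simps)
      have "a k / a j \<in> ratfun K z"
        using jk a by (intro subfield_divide[OF ratfun_subfield[OF Kr]]) (auto simp: I_def)
      with nz obtain n where n: "a k / a j / \<pi> powi n \<in> runits R" using rat_assoc[of "a k / a j"] by auto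
      have "f ^ d / \<pi> powi n \<in> runits R"
        using runits_mult[OF u n] nz by simp
      then have *: "(f ^ d / \<pi> powi n) ^ (fact m div d) \<in> runits R" by (rule runits_power)
      have "d dvd fact m" using d by (intro dvd_fact) auto
      then have "(f ^ d) ^ (fact m div d) = f ^ fact m" by (simp flip: power_mult)
      with * show ?thesis
        by (intro exI[of _ "n * int (fact m div d)"]) (simp add: power_divide power_int_mult)
    qed
    from this[of j k] this[of k j] jk show ?thesis by (cases "j < k") auto
  qed
  from discrete_valuation_if_power_associates[OF pi _ this] show ?thesis by simp
qed

section \<open>Integrality and finite fields\<close>

definition integral_over :: "'a::field set \<Rightarrow> 'a \<Rightarrow> bool" where
  "integral_over A f \<longleftrightarrow> (\<exists>p\<in>polys_over A. lead_coeff p = 1 \<and> poly p f = 0)"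

text \<open>If \<open>f\<close> were missing from \<open>A[1/f]\<close>, some valuation ring would
  contain \<open>A\<close> and \<open>1/f\<close> but not \<open>f\<close>. Hence
  \<open>f = p(1/f)\<close>, and multiplying by \<open>f ^ degree p\<close> gives a monic
  equation.\<close>

lemma integral_over_if_in_valuation_rings:
  assumes K: "is_subfield K" and A: "is_subring A" "K \<subseteq> A"
    and f: "\<And>R. valuation_ring K R \<Longrightarrow> A \<subseteq> R \<Longrightarrow> f \<in> R"
  shows "integral_over A f"
proof (cases "f = 0")
  case True
  then show ?thesis
    unfolding integral_over_def
    by (intro bexI[of _ "[:0, 1:]"])
      (auto simp: polys_over_pCons[OF A(1)] polys_over_0[OF A(1)] subring_0[OF A(1)] subring_1[OF A(1)])
next
  case False
  let ?A = "adjoin A (inverse f)"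
  have "f \<in> ?A"
  proof (rule ccontr)
    assume "f \<notin> ?A"
    then obtain R where "valuation_ring K R" "?A \<subseteq> R" "f \<notin> R"
      using exists_valuation_ring[OF K adjoin_subring[OF A(1)], of "inverse f" "inverse f"] A
        adjoin_gen[OF A(1), of "inverse f"] adjoin_superset[OF A(1), of "inverse f"] by auto
    with f[of R] adjoin_superset[OF A(1), of "inverse f"] show False by auto
  qed
  then obtain p where p: "p \<in> polys_over A" "f = poly p (inverse f)"
    by (auto simp: adjoin_def)
  define g where "g = monom 1 (Suc (degree p)) - reflect_poly p"
  have less: "degree (reflect_poly p) < degree (monom (1::'a) (Suc (degree p)))"
    using degree_reflect_poly_le[of p] by (simp add: degree_monom_eq)
  have "g \<in> polys_over A"
    unfolding g_def using p
    by (intro polys_over_diff polys_over_monom subring_1 A)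
      (auto simp: polys_over_def coeff_reflect_poly subring_0[OF A(1)])
  moreover have "lead_coeff g = 1"
  proof -
    have "degree g = Suc (degree p)"
      unfolding g_def diff_conv_add_uminus using less
      by (subst degree_add_eq_left) (simp_all add: degree_monom_eq)
    then show ?thesis by (simp add: g_def coeff_reflect_poly)
  qed
  moreover have "poly g f = 0"
    using False p(2) by (simp add: g_def poly_monom poly_reflect_poly_nz)
  ultimately show ?thesis by (auto simp: integral_over_def)
qed

section \<open>Polynomials and denominators over a transcendental element\<close>

lemma transcendental_overD:
  "transcendental_over K z \<Longrightarrow> p \<in> polys_over K \<Longrightarrow> poly p z = 0 \<longleftrightarrow> p = 0"
  by (auto simp: transcendental_over_def polys_over_def)

text \<open>The units of the polynomial ring \<open>K[z]\<close> are constants. With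
  \<open>exists_valuation_ring\<close> this yields a place at which a given nonconstant polynomial
  vanishes.\<close>

lemma inverse_poly_notin_adjoin:
  assumes K: "is_subring K" and tr: "transcendental_over K z"
    and d: "d \<in> polys_over K" "degree d > 0"
  shows "inverse (poly d z) \<notin> adjoin K z"
proof
  assume "inverse (poly d z) \<in> adjoin K z"
  then obtain p where p: "p \<in> polys_over K" "inverse (poly d z) = poly p z"
    by (auto simp: adjoin_def)
  have "poly d z \<noteq> 0" using transcendental_overD[OF tr d(1)] d(2) by auto
  with p have "poly (d * p - 1) z = 0" by (simp flip: p(2))
  then have "d * p = 1"
    using transcendental_overD[OF tr, of "d * p - 1"] d p
    by (simp add: polys_over_diff[OF K] polys_over_mult[OF K] polys_over_1[OF K])
  then have "degree (d * p) = 0" "p \<noteq> 0" "d \<noteq> 0" by auto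
  with d(2) show False by (simp add: degree_mult_eq)
qed

text \<open>Bezout's identity with all cofactors over \<open>K\<close>, not merely over the ambient
  field: \<open>g\<close> is the monic generator of the ideal \<open>I\<close>, found as an element
  of least degree.\<close>

lemma polys_over_gcd:
  assumes K: "is_subfield K" and c: "c \<in> polys_over K" and d: "d \<in> polys_over K" "d \<noteq> 0"
  obtains g u w c' d' where "u \<in> polys_over K" "w \<in> polys_over K" "c' \<in> polys_over K" "d' \<in> polys_over K"
    "lead_coeff g = 1" "g = u * c + w * d" "c = g * c'" "d = g * d'"
proof -
  note Kr = subfield_subring[OF K]
  define I where "I = {u * c + w * d | u w. u \<in> polys_over K \<and> w \<in> polys_over K}"
  have I_poly: "p \<in> polys_over K" if "p \<in> I" for p
    using that c d by (auto simp: I_def polys_over_add[OF Kr] polys_over_mult[OF Kr])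
  have I_comb: "r * p + r' * p' \<in> I"
    if "p \<in> I" "p' \<in> I" "r \<in> polys_over K" "r' \<in> polys_over K" for p p' r r'
  proof -
    obtain u w u' w' where *: "p = u * c + w * d" "p' = u' * c + w' * d" "u \<in> polys_over K" "w \<in> polys_over K"
        "u' \<in> polys_over K" "w' \<in> polys_over K"
      using \<open>p \<in> I\<close> \<open>p' \<in> I\<close> by (auto simp: I_def)
    have "r * p + r' * p' = (r * u + r' * u') * c + (r * w + r' * w') * d"
      by (simp add: * algebra_simps)
    then show ?thesis
      unfolding I_def using * that(3,4)
      by (blast intro: polys_over_add[OF Kr] polys_over_mult[OF Kr])
  qed
  have cI: "c \<in> I" "d \<in> I"
    unfolding I_def
    by (rule CollectI, rule exI[of _ 1], rule exI[of _ 0], simp add: polys_over_0[OF Kr] polys_over_1[OF Kr])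
      (rule CollectI, rule exI[of _ 0], rule exI[of _ 1], simp add: polys_over_0[OF Kr] polys_over_1[OF Kr])
  then obtain g1 where g1: "g1 \<in> I" "g1 \<noteq> 0" "\<And>p. p \<in> I \<Longrightarrow> p \<noteq> 0 \<Longrightarrow> degree g1 \<le> degree p"
    using d(2) exists_least_iff[of "\<lambda>n. \<exists>p\<in>I. p \<noteq> 0 \<and> degree p = n"] by (metis not_le)
  define a where "a = inverse (lead_coeff g1)"
  have a: "a \<noteq> 0" "a \<in> K" "[:a:] \<in> polys_over K"
    using g1 I_poly[OF g1(1)] subfield_inverse[OF K]
    by (auto simp: a_def polys_over_def polys_over_pCons[OF Kr] polys_over_0[OF Kr] coeff_pCons subring_0[OF Kr] split: nat.split)
  define g where "g = smult a g1"
  have g: "g \<in> I" "lead_coeff g = 1" "degree g = degree g1"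
    using g1 a I_comb[of g1 g1 "[:a:]" 0] by (auto simp: g_def a_def polys_over_0[OF Kr])
  have dvd: "\<exists>p'\<in>polys_over K. p = g * p'" if p: "p \<in> I" for p
  proof -
    obtain s r where sr: "s \<in> polys_over K" "r \<in> polys_over K" "p = g * s + r" "\<forall>n\<ge>degree g. coeff r n = 0"
      using polys_over_division[OF Kr I_poly[OF g(1)] g(2) I_poly[OF p]] by auto
    have "r = 1 * p + (- s) * g" using sr(3) by simp
    then have "r \<in> I"
      using I_comb[OF p g(1) polys_over_1[OF Kr] polys_over_uminus[OF Kr sr(1)]] by simp
    moreover have "degree r < degree g" if "r \<noteq> 0"
      using sr(4) that by (metis leading_coeff_0_iff not_le)
    ultimately have "r = 0" using g1(3)[of r] g(3) by fastforce
    with sr show ?thesis by auto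
  qed
  from g(1) obtain u w where "g = u * c + w * d" "u \<in> polys_over K" "w \<in> polys_over K"
    by (auto simp: I_def)
  with that g(2) dvd[OF cI(1)] dvd[OF cI(2)] show thesis by blast
qed

text \<open>For \<open>s = c / d\<close> in lowest terms, Bezout gives
  \<open>u * s + w = 1 / d\<close>, so a place where \<open>d\<close> vanishes is a pole of
  \<open>s\<close>; hence \<open>d\<close> is constant.\<close>

lemma in_adjoin_if_in_valuation_rings:
  assumes K: "is_subfield K" and tr: "transcendental_over K z" and s: "s \<in> ratfun K z"
    and in_R: "\<And>R. valuation_ring K R \<Longrightarrow> adjoin K z \<subseteq> R \<Longrightarrow> s \<in> R"
  shows "s \<in> adjoin K z"
proof -
  note Kr = subfield_subring[OF K]
  obtain c0 d0 where cd0: "s = poly c0 z / poly d0 z" "c0 \<in> polys_over K" "d0 \<in> polys_over K" "poly d0 z \<noteq> 0"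
    using s by (auto simp: ratfun_def)
  then have "d0 \<noteq> 0" by auto
  then obtain g u w c d where g: "u \<in> polys_over K" "w \<in> polys_over K" "c \<in> polys_over K" "d \<in> polys_over K"
    "lead_coeff g = 1" "g = u * c0 + w * d0" "c0 = g * c" "d0 = g * d"
    using polys_over_gcd[OF K cd0(2,3)] by metis
  have gz: "poly g z \<noteq> 0" "poly d z \<noteq> 0" using cd0(4) g(8) by auto
  have sz: "s = poly c z / poly d z" using cd0(1) gz(1) by (simp add: g(7,8))
  have "g * 1 = g * (u * c + w * d)"
    using g(6,7,8) by (simp add: algebra_simps)
  then have one: "u * c + w * d = 1" using g(5) by (metis leading_coeff_0_iff mult_left_cancel zero_neq_one)
  have inv: "poly u z * s + poly w z = inverse (poly d z)"
    using arg_cong[OF one, of "\<lambda>p. poly p z"] gz(2) by (simp add: sz field_simps)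
  show ?thesis
  proof (cases "degree d > 0")
    case True
    have "poly d z \<in> adjoin K z" using g(4) by (auto simp: adjoin_def)
    from exists_valuation_ring[OF K adjoin_subring[OF Kr] adjoin_superset[OF Kr] this
        inverse_poly_notin_adjoin[OF Kr tr g(4) True]]
    obtain R where R: "valuation_ring K R" "adjoin K z \<subseteq> R" "inverse (poly d z) \<notin> R"
      by auto
    interpret total_subring R using R(1) by (rule valuation_ring_total)
    have "poly u z \<in> R" "poly w z \<in> R" using g(1,2) R(2) by (auto simp: adjoin_def)
    with in_R[OF R(1,2)] have "poly u z * s + poly w z \<in> R"
      by (intro subring_add[OF sub] subring_mult[OF sub])
    with inv R(3) show ?thesis by simp
  next
    case False
    then obtain a where a: "d = [:a:]" by (auto elim: degree_eq_zeroE)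
    then have "inverse a \<in> K" using g(4) subfield_inverse[OF K] by (simp add: polys_over_pCons[OF Kr])
    then show ?thesis
      unfolding adjoin_def using g(3) sz a
      by (intro image_eqI[of _ _ "smult (inverse a) c"])
        (auto simp: divide_inverse mult.commute intro: polys_over_smult[OF Kr])
  qed
qed

section \<open>Power sums over a finite field\<close>

context
  fixes K :: "'a::field set"
  assumes K: "is_subfield K" and fin: "finite K"
begin

lemma card_K_gt_1: "card K > 1"
proof -
  have "{0, 1} \<subseteq> K" using subfield_subring[OF K] by (simp add: subring_0 subring_1)
  from card_mono[OF fin this] show ?thesis by simp
qed

lemma of_nat_card_K: "(of_nat (card K) :: 'a) = 0"
proof -
  note Kr = subfield_subring[OF K]
  have "bij_betw (\<lambda>a. a + 1) K K"
    by (rule bij_betwI[where g = "\<lambda>a. a - 1"]) (auto simp: subring_add[OF Kr] subring_diff[OF Kr] subring_1[OF Kr])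
  then have "(\<Sum>a\<in>K. a + 1) = (\<Sum>a\<in>K. a)" by (rule sum.reindex_bij_betw)
  then show ?thesis by (simp add: sum.distrib)
qed

lemma bij_mult_K: "g \<in> K - {0} \<Longrightarrow> bij_betw (\<lambda>u. g * u) (K - {0}) (K - {0})"
  by (rule bij_betwI[where g = "\<lambda>u. inverse g * u"])
    (auto simp: subring_mult[OF subfield_subring[OF K]] subfield_inverse[OF K])

lemma power_card_K:
  assumes "u \<in> K - {0}"
  shows "u ^ (card K - 1) = 1"
proof -
  have "(\<Prod>w\<in>K - {0}. u * w) = (\<Prod>w\<in>K - {0}. w)"
    by (rule prod.reindex_bij_betw[OF bij_mult_K[OF assms]])
  then show ?thesis
    using fin by (simp add: prod.distrib subring_0[OF subfield_subring[OF K]])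
qed

text \<open>The orthogonality relation behind the averaging over conjugates. If some
  \<open>g ^ n\<close> differs from \<open>1\<close>, multiplication by \<open>g\<close> permutes
  the index set and scales the sum, which must vanish; if every summand is \<open>1\<close>, the sum
  is \<open>card K - 1\<close>, and \<open>card K\<close> is \<open>0\<close> in the field.\<close>

lemma sum_power_K:
  "(\<Sum>u\<in>K - {0}. u ^ n) = (if (card K - 1) dvd n then - 1 else 0)"
proof (cases "(card K - 1) dvd n")
  case True
  then obtain l where "n = (card K - 1) * l" by (elim dvdE)
  then have "(\<Sum>u\<in>K - {0}. u ^ n) = (\<Sum>u\<in>K - {0}. 1)"
    by (intro sum.cong) (auto simp: power_mult power_card_K simp del: One_nat_def)
  also have "\<dots> = of_nat (card K - 1)"
    using fin by (simp add: subring_0[OF subfield_subring[OF K]])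
  also have "\<dots> = - 1"
    using card_K_gt_1 of_nat_card_K by (subst of_nat_diff) auto
  finally show ?thesis using True by simp
next
  case False
  \<comment> \<open>Reduced below \<open>card K - 1\<close>, so that \<open>X ^ r - 1\<close> has
    too few roots to vanish at every nonzero element of \<open>K\<close>.\<close>
  define r where "r = n mod (card K - 1)"
  have r: "0 < r" "r < card K - 1"
    using False card_K_gt_1 by (auto simp: r_def dvd_eq_mod_eq_0)
  have un: "u ^ n = u ^ r" if "u \<in> K - {0}" for u
  proof -
    have "u ^ n = u ^ ((card K - 1) * (n div (card K - 1)) + r)" by (simp add: r_def)
    also have "\<dots> = u ^ r" unfolding power_add power_mult power_card_K[OF that] by simp
    finally show ?thesis .
  qed
  obtain g where g: "g \<in> K - {0}" "g ^ n \<noteq> 1"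
  proof (rule ccontr)
    assume "\<not> thesis"
    then have *: "u ^ r = 1" if "u \<in> K - {0}" for u using un[OF that] that \<open>\<And>g. \<lbrakk>g \<in> K - {0}; g ^ n \<noteq> 1\<rbrakk> \<Longrightarrow> thesis\<close> by metis
    define P where "P = monom (1::'a) r - 1"
    have "coeff P r = 1" using r by (simp add: P_def)
    then have "P \<noteq> 0" by auto
    have "K - {0} \<subseteq> {u. poly P u = 0}" using * by (auto simp: P_def poly_monom)
    then have "card (K - {0}) \<le> card {u. poly P u = 0}"
      using \<open>P \<noteq> 0\<close> by (intro card_mono poly_roots_finite) auto
    also have "\<dots> \<le> degree P" using \<open>P \<noteq> 0\<close> by (rule card_poly_roots_bound)
    also have "\<dots> \<le> r" unfolding P_def by (intro degree_diff_le) (auto simp: degree_monom_le)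
    finally show False using r fin by (simp add: subring_0[OF subfield_subring[OF K]])
  qed
  have "(\<Sum>u\<in>K - {0}. (g * u) ^ n) = (\<Sum>u\<in>K - {0}. u ^ n)"
    by (rule sum.reindex_bij_betw[OF bij_mult_K[OF g(1)]])
  then have "g ^ n * (\<Sum>u\<in>K - {0}. u ^ n) = (\<Sum>u\<in>K - {0}. u ^ n)"
    by (simp add: power_mult_distrib sum_distrib_left)
  then have "(g ^ n - 1) * (\<Sum>u\<in>K - {0}. u ^ n) = 0"
    by (simp add: left_diff_distrib)
  with g False show ?thesis by simp
qed

end

section \<open>The field \<open>K(x, y)\<close> and its place at zero\<close>

context discrete_valuation
begin

lemma v_const:
  assumes "is_subfield K" "K \<subseteq> R" "a \<in> K" "a \<noteq> 0"
  shows "v a = 0"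
  using assms subfield_inverse[of K a] runits_v[of a] by (auto simp: runits_def)

lemma v_poly_unit:
  assumes K: "is_subfield K" "K \<subseteq> R" and z: "v z > 0" "z \<noteq> 0"
    and p: "p \<in> polys_over K" "coeff p 0 \<noteq> 0"
  shows "poly p z \<noteq> 0 \<and> v (poly p z) = 0"
proof -
  obtain a p' where pc: "p = pCons a p'" by (cases p)
  then have a: "a \<in> K" "a \<noteq> 0" "p' \<in> polys_over K"
    using p by (auto simp: polys_over_pCons[OF subfield_subring[OF K(1)]])
  have "z \<in> R" using z by (simp add: in_iff)
  then have "poly p' z \<in> R"
    using a polys_over_mono[OF K(2)] by (intro poly_in_subring[OF sub]) auto
  show ?thesis
  proof (cases "poly p' z = 0")
    case True
    then show ?thesis using a by (simp add: pc v_const[OF K])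
  next
    case False
    with \<open>poly p' z \<in> R\<close> z have "v (z * poly p' z) > 0"
      by (simp add: v_mult in_iff)
    with a False z v_add_distinct[of a "z * poly p' z"] show ?thesis
      by (simp add: pc v_const[OF K])
  qed
qed

end

text \<open>Stated with one coprimality condition, so that the equation in \<open>inverse x\<close>
  is another instance: its exponent is \<open>- i - 2\<close>, coprime to \<open>m\<close> by the
  condition on \<open>i + 2\<close>.\<close>

locale kummer =
  fixes K :: "'a::field set" and x y :: 'a and m :: nat and i :: int
  assumes K: "is_subfield K" and fin: "finite K" and odd_card: "odd (card K)"
    and m: "m > 0" and m_dvd: "m dvd card K - 1"
    and coprime_i: "gcd i (int m) = 1"
    and trans: "transcendental_over K x"
    and y_power: "y ^ m = x powi i * (x ^ 2 + 1)"
    and gen: "is_subfield hull (K \<union> {x, y}) = UNIV"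
begin

lemmas Kr = subfield_subring[OF K]

lemma poly_x_eq_0: "p \<in> polys_over K \<Longrightarrow> poly p x = 0 \<longleftrightarrow> p = 0"
  by (rule transcendental_overD[OF trans])

lemma x_neq_0: "x \<noteq> 0"
  using poly_x_eq_0[of "[:0, 1:]"]
  by (auto simp: polys_over_pCons[OF Kr] polys_over_0[OF Kr] subring_0[OF Kr] subring_1[OF Kr])

lemma x2_poly: "[:1, 0, 1:] \<in> polys_over K"
  by (auto simp: polys_over_pCons[OF Kr] polys_over_0[OF Kr] subring_0[OF Kr] subring_1[OF Kr])

lemma poly_x2: "poly [:1, 0, 1:] x = x ^ 2 + 1"
  by (simp add: power2_eq_square)

lemma x2_neq_0: "x ^ 2 + 1 \<noteq> 0"
  using poly_x_eq_0[OF x2_poly] unfolding poly_x2 by simp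

lemma y_neq_0: "y \<noteq> 0"
  using y_power x_neq_0 x2_neq_0 m by (auto simp: zero_power)

lemma two_neq_0: "(2::'a) \<noteq> 0"
proof
  assume "(2::'a) = 0"
  moreover obtain l where "card K = 2 * l + 1" using odd_card by (auto elim: oddE)
  ultimately have "(of_nat (card K) :: 'a) = 1" by simp
  then show False using of_nat_card_K[OF K fin] by simp
qed

abbreviation L :: "'a set" where "L \<equiv> ratfun K x"

lemmas L = ratfun_subfield[OF Kr, of x]
lemmas Lr = subfield_subring[OF L]

lemma K_subset_L: "K \<subseteq> L" and x_in_L: "x \<in> L"
  using adjoin_subset_ratfun[OF Kr, of x] adjoin_superset[OF Kr, of x] adjoin_gen[OF Kr, of x] by auto

lemma y_power_in_L: "y ^ m \<in> L"
  unfolding y_power using x_in_L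
  by (intro subring_mult[OF Lr] subring_add[OF Lr] subring_power[OF Lr] subring_1[OF Lr] subfield_powi[OF L])

definition y_poly :: "'a poly" where
  "y_poly = monom 1 m - [:y ^ m:]"

lemma y_poly: "y_poly \<in> polys_over L" "degree y_poly = m" "lead_coeff y_poly = 1"
    "poly y_poly w = w ^ m - y ^ m"
proof -
  show "y_poly \<in> polys_over L"
    unfolding y_poly_def using y_power_in_L
    by (intro polys_over_diff[OF Lr] polys_over_monom[OF Lr] subring_1[OF Lr])
      (auto simp: polys_over_pCons[OF Lr] polys_over_0[OF Lr])
  show *: "degree y_poly = m"
    unfolding y_poly_def diff_conv_add_uminus using m
    by (subst degree_add_eq_left) (auto simp: degree_monom_eq)
  show "lead_coeff y_poly = 1"
    unfolding * using m by (simp add: y_poly_def coeff_pCons split: nat.split)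
qed (simp add: y_poly_def poly_monom)

text \<open>Remainders modulo \<open>y_poly\<close>: candidates for coordinates with respect to
  \<open>1, y, ..., y^(m-1)\<close>, whose uniqueness will come from valuations.\<close>

definition reps :: "'a poly set" where
  "reps = {r \<in> polys_over L. \<forall>n\<ge>m. coeff r n = 0}"

lemma poly_rep:
  assumes "r \<in> reps"
  shows "poly r w = (\<Sum>j<m. coeff r j * w ^ j)"
proof -
  have "degree r \<le> m" using assms by (intro degree_le) (auto simp: reps_def)
  then have "poly r w = (\<Sum>j\<le>m. coeff r j * w ^ j)"
    unfolding poly_altdef by (intro sum.mono_neutral_left) (auto simp: coeff_eq_0)
  also have "\<dots> = (\<Sum>j<m. coeff r j * w ^ j)"
    using assms by (intro sum.mono_neutral_right) (auto simp: reps_def not_less)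
  finally show ?thesis .
qed

lemma rep_exists_adjoin:
  assumes "f \<in> adjoin L y"
  shows "\<exists>r\<in>reps. f = poly r y"
proof -
  obtain p where p: "p \<in> polys_over L" "f = poly p y"
    using assms by (auto simp: adjoin_def)
  obtain s r where "s \<in> polys_over L" "r \<in> polys_over L" "p = y_poly * s + r" "\<forall>n\<ge>degree y_poly. coeff r n = 0"
    using polys_over_division[OF Lr y_poly(1,3) p(1)] by auto
  then show ?thesis using p y_poly(2,4) by (intro bexI[of _ r]) (auto simp: reps_def)
qed

text \<open>The \<open>m + 1\<close> powers of \<open>f\<close> up to \<open>f ^ m\<close> have only
  \<open>m\<close> coordinates each, so they are dependent over \<open>K(x)\<close>. The bound
  \<open>m\<close> is the same for all \<open>f\<close>, as the discreteness argument
  requires.\<close>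

lemma algebraic_adjoin:
  assumes f: "f \<in> adjoin L y"
  shows "\<exists>a. (\<forall>k\<le>m. a k \<in> L) \<and> (\<exists>k\<le>m. a k \<noteq> 0) \<and> (\<Sum>k\<le>m. a k * f ^ k) = 0"
proof -
  have "\<exists>r. \<forall>k. r k \<in> reps \<and> f ^ k = poly (r k) y"
    using rep_exists_adjoin subring_power[OF adjoin_subring[OF Lr] f] by (intro choice) blast
  then obtain r where r: "\<And>k. r k \<in> reps" "\<And>k. f ^ k = poly (r k) y" by auto
  have "\<exists>d. (\<forall>k\<in>{..m}. d k \<in> L) \<and> (\<exists>k\<in>{..m}. d k \<noteq> 0) \<and>
      (\<forall>j\<in>{..<m}. (\<Sum>k\<in>{..m}. d k * coeff (r k) j) = 0)"
    using r(1) by (intro linear_dependency[OF L]) (auto simp: reps_def polys_over_def)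
  then obtain d where d: "\<forall>k\<le>m. d k \<in> L" "\<exists>k\<le>m. d k \<noteq> 0" "\<And>j. j < m \<Longrightarrow> (\<Sum>k\<le>m. d k * coeff (r k) j) = 0"
    by auto
  have "(\<Sum>k\<le>m. d k * f ^ k) = (\<Sum>k\<le>m. \<Sum>j<m. d k * coeff (r k) j * y ^ j)"
    by (simp add: r(2) poly_rep[OF r(1)] sum_distrib_left mult_ac)
  also have "\<dots> = (\<Sum>j<m. \<Sum>k\<le>m. d k * coeff (r k) j * y ^ j)" by (rule sum.swap)
  also have "\<dots> = (\<Sum>j<m. (\<Sum>k\<le>m. d k * coeff (r k) j) * y ^ j)"
    by (simp add: sum_distrib_right)
  also have "\<dots> = 0" using d(3) by (intro sum.neutral) auto
  finally show ?thesis using d by auto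
qed

text \<open>A relation of least degree has a nonzero constant term, since otherwise \<open>f\<close>
  could be cancelled; it then expresses \<open>inverse f\<close> polynomially in
  \<open>f\<close>.\<close>

lemma inverse_in_adjoin:
  assumes f: "f \<in> adjoin L y"
  shows "inverse f \<in> adjoin L y"
proof (cases "f = 0")
  case True
  then show ?thesis using f by simp
next
  case False
  note Ar = adjoin_subring[OF Lr, of y]
  have LA: "L \<subseteq> adjoin L y" by (rule adjoin_superset[OF Lr])
  define Q where "Q n \<longleftrightarrow> (\<exists>p\<in>polys_over L. p \<noteq> 0 \<and> degree p = n \<and> poly p f = 0)" for n
  obtain a where a: "\<forall>k\<le>m. a k \<in> L" "\<exists>k\<le>m. a k \<noteq> 0" "(\<Sum>k\<le>m. a k * f ^ k) = 0"
    using algebraic_adjoin[OF f] by blast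
  define p where "p = (\<Sum>k\<le>m. monom (a k) k)"
  have cp: "coeff p j = (if j \<le> m then a j else 0)" for j
    by (simp add: p_def coeff_sum)
  have "p \<in> polys_over L"
    using a(1) by (auto simp: polys_over_def cp subring_0[OF Lr])
  moreover have "p \<noteq> 0" using a(2) cp by (metis coeff_0)
  moreover have "poly p f = 0" using a(3) by (simp add: p_def poly_sum poly_monom)
  ultimately have "Q (degree p)" by (auto simp: Q_def)
  then obtain n where n: "Q n" "\<And>l. l < n \<Longrightarrow> \<not> Q l"
    using exists_least_iff[of Q] by blast
  then obtain p where p: "p \<in> polys_over L" "p \<noteq> 0" "degree p = n" "poly p f = 0"
    by (auto simp: Q_def)
  obtain c p' where pc: "p = pCons c p'" by (cases p)
  have cL: "c \<in> L" "p' \<in> polys_over L" using p(1) by (auto simp: pc polys_over_pCons[OF Lr])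
  have p'0: "p' \<noteq> 0" if "c = 0" using p(2) pc that by auto
  have "c \<noteq> 0"
  proof
    assume c: "c = 0"
    then have "poly p' f = 0" using p(4) False by (simp add: pc)
    moreover have "degree p' < n" using p(3) p'0[OF c] by (simp add: pc)
    ultimately show False using n(2)[of "degree p'"] cL p'0[OF c] by (auto simp: Q_def)
  qed
  moreover have "f * poly p' f = - c"
    using p(4) by (simp add: pc eq_neg_iff_add_eq_0 add.commute)
  ultimately have "inverse f = - inverse c * poly p' f"
    using False by (simp add: field_simps)
  moreover have "poly p' f \<in> adjoin L y"
    using cL(2) polys_over_mono[OF LA] by (intro poly_in_subring[OF Ar _ f]) auto
  moreover have "- inverse c \<in> adjoin L y"
    using LA cL(1) subfield_inverse[OF L] subring_uminus[OF Lr] by auto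
  ultimately show ?thesis using subring_mult[OF Ar] by metis
qed

lemma adjoin_L_y: "adjoin L y = UNIV"
proof -
  have "is_subfield (adjoin L y)"
    using adjoin_subring[OF Lr] inverse_in_adjoin by (auto simp: is_subfield_def)
  then have "is_subfield hull (K \<union> {x, y}) \<subseteq> adjoin L y"
    using adjoin_superset[OF Lr, of y] adjoin_gen[OF Lr, of y] K_subset_L x_in_L
    by (intro hull_minimal) auto
  then show ?thesis using gen by (simp add: top.extremum_unique)
qed

lemma rep_exists: "\<exists>r\<in>reps. f = poly r y"
  using rep_exists_adjoin adjoin_L_y by blast

text \<open>The criterion needs an element of \<open>R\<close> over whose rational functions the
  field is algebraic: \<open>x\<close> or \<open>inverse x\<close>, whichever lies in
  \<open>R\<close>.\<close>

lemma place_discrete: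
  assumes R: "valuation_ring K R"
  shows "\<exists>v. discrete_valuation R v"
proof -
  interpret total_subring R using R by (rule valuation_ring_total)
  have KR: "K \<subseteq> R" "R \<noteq> UNIV" using R by (auto simp: valuation_ring_def)
  have alg: "\<exists>a. (\<forall>k\<le>m. a k \<in> L) \<and> (\<exists>k\<le>m. a k \<noteq> 0) \<and> (\<Sum>k\<le>m. a k * f ^ k) = 0" for f
    by (rule algebraic_adjoin) (simp add: adjoin_L_y)
  from total[of x] show ?thesis
  proof
    assume "x \<in> R"
    with alg show ?thesis by (intro discrete_valuation_if_algebraic[OF K KR(1) _ KR(2)])
  next
    assume "inverse x \<in> R"
    with alg show ?thesis
      by (intro discrete_valuation_if_algebraic[OF K KR(1) _ KR(2)]) (auto simp: ratfun_inverse[OF Kr])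
  qed
qed

lemma poly_factor_x:
  assumes "p \<in> polys_over K" "p \<noteq> 0"
  shows "\<exists>n::nat. \<exists>p'\<in>polys_over K. coeff p' 0 \<noteq> 0 \<and> poly p x = x ^ n * poly p' x"
  using assms
proof (induction p)
  case (pCons a p)
  show ?case
  proof (cases "a = 0")
    case True
    with pCons obtain n p' where "p' \<in> polys_over K" "coeff p' 0 \<noteq> 0" "poly p x = x ^ n * poly p' x"
      by (auto simp: polys_over_pCons[OF Kr])
    then show ?thesis using True by (intro exI[of _ "Suc n"] bexI[of _ p']) auto
  next
    case False
    with pCons.prems show ?thesis by (intro exI[of _ 0] bexI[of _ "pCons a p"]) auto
  qed
qed simp

lemma L_factor_x:
  assumes "h \<in> L" "h \<noteq> 0"
  shows "\<exists>n::int. \<exists>p\<in>polys_over K. \<exists>r\<in>polys_over K. coeff p 0 \<noteq> 0 \<and> coeff r 0 \<noteq> 0 \<and>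
    h = x powi n * (poly p x / poly r x)"
proof -
  from assms(1) obtain p r where h: "h = poly p x / poly r x" "p \<in> polys_over K" "r \<in> polys_over K" "poly r x \<noteq> 0"
    by (auto simp: ratfun_def)
  then have "p \<noteq> 0" "r \<noteq> 0" using assms(2) by auto
  with poly_factor_x[OF h(2)] poly_factor_x[OF h(3)] obtain n p' n' r' where
    *: "p' \<in> polys_over K" "coeff p' 0 \<noteq> 0" "poly p x = x ^ n * poly p' x"
      "r' \<in> polys_over K" "coeff r' 0 \<noteq> 0" "poly r x = x ^ n' * poly r' x"
    by auto
  have "h = x powi (int n - int n') * (poly p' x / poly r' x)"
    using h(1) * x_neq_0 by (simp add: power_int_diff)
  with * show ?thesis by blast
qed

end

section \<open>Total ramification and uniqueness of the place over \<open>x = 0\<close>\<close>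

locale kummer_zero = kummer K x y m i + discrete_valuation R v
  for K :: "'a::field set" and x y :: 'a and m :: nat and i :: int and R :: "'a set" and v :: "'a \<Rightarrow> int" +
  assumes KR: "K \<subseteq> R" and vx: "v x > 0"
begin

lemma v_poly: "p \<in> polys_over K \<Longrightarrow> coeff p 0 \<noteq> 0 \<Longrightarrow> poly p x \<noteq> 0 \<and> v (poly p x) = 0"
  using v_poly_unit[OF K KR vx x_neq_0] by blast

lemma v_factor_x:
  assumes "p \<in> polys_over K" "r \<in> polys_over K" "coeff p 0 \<noteq> 0" "coeff r 0 \<noteq> 0"
  shows "v (x powi n * (poly p x / poly r x)) = n * v x"
proof -
  have nz: "poly p x / poly r x \<noteq> 0" "x powi n \<noteq> 0"
    using v_poly[OF assms(1,3)] v_poly[OF assms(2,4)] x_neq_0 by auto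
  then have "v (x powi n * (poly p x / poly r x)) = v (x powi n) + v (poly p x / poly r x)"
    by (intro v_mult)
  also have "v (poly p x / poly r x) = 0"
    using v_poly[OF assms(1,3)] v_poly[OF assms(2,4)] by (simp add: v_divide)
  finally show ?thesis using x_neq_0 by (simp add: v_powi)
qed

lemma m_v_y: "int m * v y = i * v x"
proof -
  have "v (x ^ 2 + 1) = 0"
    using v_poly[OF x2_poly] unfolding poly_x2 by simp
  then have "v (y ^ m) = i * v x"
    unfolding y_power using x_neq_0 x2_neq_0 by (simp add: v_mult v_powi)
  then show ?thesis using y_neq_0 by (simp add: v_power)
qed

lemma v_L: "h \<in> L \<Longrightarrow> h \<noteq> 0 \<Longrightarrow> \<exists>n. v h = n * v x"
  using L_factor_x v_factor_x by metis

lemma v_term: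
  assumes "h \<in> L" "h \<noteq> 0"
  shows "\<exists>n. int m * v (h * y ^ j) = v x * (int m * n + i * int j)"
proof -
  obtain n where "v h = n * v x" using v_L[OF assms] by auto
  then have "int m * v (h * y ^ j) = int m * (n * v x) + int j * (int m * v y)"
    using assms y_neq_0 by (simp add: v_mult v_power algebra_simps)
  then show ?thesis by (intro exI[of _ n]) (simp add: m_v_y algebra_simps)
qed

text \<open>After removal of the factor \<open>v x\<close>, \<open>m\<close> times the value of a
  term is congruent to \<open>i * j\<close> modulo \<open>m\<close>, and \<open>i\<close> is
  invertible there. Multiplying by \<open>m\<close> avoids the exact values of \<open>x\<close> and
  \<open>y\<close>, which are still unknown.\<close>

lemma v_term_distinct:
  assumes h: "h \<in> L" "h \<noteq> 0" "h' \<in> L" "h' \<noteq> 0" and j: "j < m" "j' < m"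
    and eq: "v (h * y ^ j) = v (h' * y ^ j')"
  shows "j = j'"
proof -
  obtain n n' where n: "int m * v (h * y ^ j) = v x * (int m * n + i * int j)"
      "int m * v (h' * y ^ j') = v x * (int m * n' + i * int j')"
    using v_term h by metis
  then have "int m * n + i * int j = int m * n' + i * int j'"
    using eq vx by simp
  then have "int m * (n' - n) = i * (int j - int j')" by (simp add: algebra_simps)
  then have "int m dvd i * (int j - int j')" by (metis dvd_triv_left)
  then have "int m dvd int j - int j'"
    using coprime_i by (metis coprime_commute coprime_dvd_mult_right_iff coprime_iff_gcd_eq_1)
  moreover have "\<bar>int j - int j'\<bar> < int m" using j by linarith
  ultimately have "int j - int j' = 0" by (meson dvd_imp_le_int linorder_not_le abs_of_nat zdvd_not_zless
      dvd_abs_iff abs_ge_zero order_le_imp_less_or_eq zero_less_abs_iff)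
  then show ?thesis by simp
qed

lemma v_rep:
  assumes r: "r \<in> reps" "r \<noteq> 0"
  shows "poly r y \<noteq> 0 \<and> (\<exists>j<m. coeff r j \<noteq> 0 \<and> v (poly r y) = v (coeff r j * y ^ j) \<and>
     (\<forall>k. coeff r k \<noteq> 0 \<longrightarrow> v (poly r y) \<le> v (coeff r k * y ^ k)))"
proof -
  define J where "J = {j. j < m \<and> coeff r j \<noteq> 0}"
  have rL: "coeff r j \<in> L" for j using r by (auto simp: reps_def polys_over_def)
  have "coeff r (degree r) \<noteq> 0" using r by simp
  then have "degree r \<in> J" using r(1) by (auto simp: J_def reps_def not_le[symmetric])
  moreover have "inj_on (\<lambda>j. v (coeff r j * y ^ j)) J"
    using v_term_distinct[OF rL _ rL] by (intro inj_onI) (auto simp: J_def)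
  ultimately have "\<exists>j\<in>J. (\<Sum>j\<in>J. coeff r j * y ^ j) \<noteq> 0 \<and>
      v (\<Sum>j\<in>J. coeff r j * y ^ j) = v (coeff r j * y ^ j) \<and>
      (\<forall>k\<in>J. v (coeff r j * y ^ j) \<le> v (coeff r k * y ^ k))"
    using y_neq_0 by (intro v_sum_distinct) (auto simp: J_def)
  then obtain j where j: "j \<in> J" "(\<Sum>j\<in>J. coeff r j * y ^ j) \<noteq> 0"
      "v (\<Sum>j\<in>J. coeff r j * y ^ j) = v (coeff r j * y ^ j)"
      "\<forall>k\<in>J. v (coeff r j * y ^ j) \<le> v (coeff r k * y ^ k)"
    by auto
  have "poly r y = (\<Sum>j\<in>J. coeff r j * y ^ j)"
    unfolding poly_rep[OF r(1)] by (intro sum.mono_neutral_right) (auto simp: J_def)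
  moreover have "k \<in> J" if "coeff r k \<noteq> 0" for k
    using that r(1) by (auto simp: J_def reps_def not_le[symmetric])
  ultimately show ?thesis using j by (auto simp: J_def)
qed

text \<open>Linear independence over \<open>K(x)\<close> comes from distinct valuations rather than
  from irreducibility of \<open>Y^m - y^m\<close>.\<close>

lemma y_powers_independent: "r \<in> reps \<Longrightarrow> poly r y = 0 \<Longrightarrow> r = 0"
  using v_rep by blast

text \<open>Total ramification. An element of value \<open>1\<close> has a term of value
  \<open>1\<close>, which forces \<open>v x\<close> to divide \<open>m\<close>; conversely
  \<open>m * v y = i * v x\<close> and coprimality make \<open>m\<close> divide
  \<open>v x\<close>.\<close>

lemma v_x: "v x = int m"
proof -
  obtain t where t: "t \<noteq> 0" "v t = 1" using uniformizer by auto
  obtain r where r: "r \<in> reps" "t = poly r y" using rep_exists by auto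
  with t have "r \<noteq> 0" by auto
  with v_rep r t obtain j where j: "coeff r j \<noteq> 0" "v (coeff r j * y ^ j) = 1" by metis
  have "coeff r j \<in> L" using r(1) by (auto simp: reps_def polys_over_def)
  from v_term[OF this j(1), of j] j(2) have "v x dvd int m" by (metis dvd_triv_left mult.right_neutral)
  moreover have "int m dvd i * v x" by (metis m_v_y dvd_triv_left)
  then have "int m dvd v x"
    using coprime_i by (metis coprime_commute coprime_dvd_mult_right_iff coprime_iff_gcd_eq_1)
  ultimately show ?thesis using vx by (intro zdvd_antisym_nonneg) auto
qed

lemma v_y: "v y = i"
  using m_v_y v_x m by simp

end

context kummer
begin

text \<open>The values \<open>v x = m\<close> and \<open>v y = i\<close> fix the value of every term
  \<open>h * y ^ j\<close>, and the value of a function is the least among its terms.\<close>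

lemma zero_unique:
  assumes "kummer_zero K x y m i R v" "kummer_zero K x y m i R' v'"
  shows "R = R'"
proof -
  interpret A: kummer_zero K x y m i R v by fact
  interpret B: kummer_zero K x y m i R' v' by fact
  have eq: "v (h * y ^ j) = v' (h * y ^ j)" if "h \<in> L" "h \<noteq> 0" for h j
  proof -
    from L_factor_x[OF that] obtain n p r where
      "p \<in> polys_over K" "r \<in> polys_over K" "coeff p 0 \<noteq> 0" "coeff r 0 \<noteq> 0"
      "h = x powi n * (poly p x / poly r x)" by blast
    then have "v h = v' h" using A.v_factor_x B.v_factor_x A.v_x B.v_x by simp
    then show ?thesis
      using that y_neq_0 by (simp add: A.v_mult B.v_mult A.v_power B.v_power A.v_y B.v_y)
  qed
  have "v f = v' f" if "f \<noteq> 0" for f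
  proof -
    obtain r where r: "r \<in> reps" "f = poly r y" using rep_exists by auto
    with that have "r \<noteq> 0" by auto
    have "coeff r j \<in> L" for j using r(1) by (auto simp: reps_def polys_over_def)
    with A.v_rep[OF r(1) \<open>r \<noteq> 0\<close>] B.v_rep[OF r(1) \<open>r \<noteq> 0\<close>] eq r(2) show ?thesis
      by (metis order_antisym)
  qed
  then show ?thesis
    using A.in_iff B.in_iff subring_0[OF A.sub] subring_0[OF B.sub] by (metis set_eqI)
qed

lemma zero_exists: "\<exists>R v. valuation_ring K R \<and> kummer_zero K x y m i R v"
proof -
  have "x = poly [:0, 1:] x" "[:0, 1:] \<in> polys_over K" "degree [:0, 1::'a:] > 0"
    by (auto simp: polys_over_pCons[OF Kr] polys_over_0[OF Kr] subring_0[OF Kr] subring_1[OF Kr])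
  then have "inverse x \<notin> adjoin K x"
    using inverse_poly_notin_adjoin[OF Kr trans, of "[:0, 1:]"] by simp
  then obtain R where R: "valuation_ring K R" "adjoin K x \<subseteq> R" "inverse x \<notin> R"
    using exists_valuation_ring[OF K adjoin_subring[OF Kr] adjoin_superset[OF Kr] adjoin_gen[OF Kr]] by blast
  obtain v where v: "discrete_valuation R v" using place_discrete[OF R(1)] by auto
  interpret discrete_valuation R v by (rule v)
  have "v x > 0" using R(3) x_neq_0 in_iff[of "inverse x"] by (simp add: v_inverse)
  then have "kummer_zero K x y m i R v"
    using R(1) by unfold_locales (auto simp: valuation_ring_def)
  with R show ?thesis by auto
qed

end

section \<open>Components of functions with poles only over zero\<close>

context kummer
begin

text \<open>Every relation satisfied by \<open>y\<close> over \<open>K(x)\<close> is a multiple of \<open>Y^m - y^m\<close>, so it is satisfied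
  by the conjugates \<open>w\<close> of \<open>y\<close> as well.\<close>

lemma conjugate_root:
  assumes p: "p \<in> polys_over L" "poly p y = 0" and w: "w ^ m = y ^ m"
  shows "poly p w = 0"
proof -
  obtain s r where sr: "s \<in> polys_over L" "r \<in> polys_over L" "p = y_poly * s + r" "\<forall>n\<ge>degree y_poly. coeff r n = 0"
    using polys_over_division[OF Lr y_poly(1,3) p(1)] by auto
  have "r \<in> reps" using sr y_poly(2) by (auto simp: reps_def)
  moreover have "poly r y = 0" using p(2) by (simp add: sr(3) y_poly(4))
  moreover obtain R v where "kummer_zero K x y m i R v" using zero_exists by auto
  ultimately have "r = 0" by (intro kummer_zero.y_powers_independent)
  then show ?thesis using w by (simp add: sr(3) y_poly(4))
qed

text \<open>The integral equation \<open>g\<close> composed with \<open>r\<close> is a relation for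
  \<open>y\<close>, so the conjugate \<open>w\<close> satisfies it as well.\<close>

lemma conjugate_integral:
  assumes A: "A \<subseteq> L" and r: "r \<in> polys_over L" and int: "integral_over A (poly r y)"
    and w: "w ^ m = y ^ m"
  shows "integral_over A (poly r w)"
proof -
  obtain g where g: "g \<in> polys_over A" "lead_coeff g = 1" "poly g (poly r y) = 0"
    using int by (auto simp: integral_over_def)
  have "poly (pcompose g r) w = 0"
  proof (rule conjugate_root[OF _ _ w])
    show "pcompose g r \<in> polys_over L"
      using g(1) polys_over_mono[OF A] r by (intro polys_over_pcompose[OF Lr]) auto
  qed (simp add: g(3) poly_pcompose)
  then have "poly g (poly r w) = 0" by (simp add: poly_pcompose)
  with g(1,2) show ?thesis unfolding integral_over_def by blast
qed

text \<open>The powers \<open>u\<^sup>c\<close> with \<open>u \<in> K\<^sup>*\<close> and \<open>c = (|K| - 1) / m\<close> are \<open>m\<close>-th roots of unity, and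
  averaging over the conjugates \<open>u\<^sup>c y\<close> of \<open>y\<close> isolates one component.\<close>

lemma component_in_valuation_rings:
  assumes A: "is_subring A" "K \<subseteq> A" "A \<subseteq> L" and r: "r \<in> reps" and j0: "j0 < m"
    and in_R: "\<And>R. valuation_ring K R \<Longrightarrow> A \<subseteq> R \<Longrightarrow> poly r y \<in> R"
    and R: "valuation_ring K R" "A \<subseteq> R"
  shows "coeff r j0 * y ^ j0 \<in> R"
proof -
  interpret total_subring R using R(1) by (rule valuation_ring_total)
  define c where "c = (card K - 1) div m"
  have cm: "c * m = card K - 1" using m_dvd by (simp add: c_def)
  have c: "c > 0" using cm card_K_gt_1[OF K fin] by (intro gr0I) auto
  have int: "integral_over A (poly r y)"
    using A in_R by (intro integral_over_if_in_valuation_rings[OF K])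
  have conj: "poly r (u ^ c * y) \<in> R" if "u \<in> K - {0}" for u
  proof -
    have "(u ^ c * y) ^ m = u ^ (card K - 1) * y ^ m"
      unfolding cm[symmetric] power_mult_distrib power_mult ..
    then have "(u ^ c * y) ^ m = y ^ m"
      unfolding power_card_K[OF K fin that] by simp
    then have "integral_over A (poly r (u ^ c * y))"
      using r by (intro conjugate_integral[OF A(3) _ int]) (auto simp: reps_def)
    then obtain g where "g \<in> polys_over A" "lead_coeff g = 1 \<and> poly g (poly r (u ^ c * y)) = 0"
      unfolding integral_over_def by (rule bexE)
    then show ?thesis
      using polys_over_mono[OF R(2)] by (intro integrally_closed[of g]) auto
  qed
  \<comment> \<open>The weight \<open>u ^ e\<close> gives component \<open>j\<close> the exponent
    \<open>c * (j + (m - j0))\<close>, a nonnegative substitute for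
    \<open>c * (j - j0)\<close>.\<close>
  define e where "e = c * (m - j0)"
  have "(\<Sum>u\<in>K - {0}. u ^ e * poly r (u ^ c * y)) =
      (\<Sum>u\<in>K - {0}. \<Sum>j<m. coeff r j * y ^ j * u ^ (c * (j + (m - j0))))"
    unfolding poly_rep[OF r] sum_distrib_left
  proof (intro sum.cong refl)
    fix u :: 'a and j :: nat
    have "(u ^ c * y) ^ j = u ^ (c * j) * y ^ j" by (simp add: power_mult_distrib power_mult)
    moreover have "u ^ (c * (j + (m - j0))) = u ^ (c * j) * u ^ e"
      unfolding e_def distrib_left power_add ..
    ultimately show "u ^ e * (coeff r j * (u ^ c * y) ^ j) = coeff r j * y ^ j * u ^ (c * (j + (m - j0)))"
      by (simp only: mult_ac)
  qed
  also have "\<dots> = (\<Sum>j<m. coeff r j * y ^ j * (\<Sum>u\<in>K - {0}. u ^ (c * (j + (m - j0)))))"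
    by (subst sum.swap) (simp add: sum_distrib_left)
  also have "\<dots> = (\<Sum>j<m. if j = j0 then - (coeff r j * y ^ j) else 0)"
  proof (intro sum.cong refl)
    \<comment> \<open>Since \<open>0 < j + (m - j0) < 2 * m\<close>, divisibility by
      \<open>m\<close> means \<open>j = j0\<close>. The sum runs over all nonzero \<open>u\<close>
      instead of the roots of unity, so the surviving factor is \<open>- 1\<close> and no division
      by \<open>m\<close> occurs.\<close>
    fix j assume j: "j \<in> {..<m}"
    have "(card K - 1) dvd c * (j + (m - j0)) \<longleftrightarrow> m dvd j + (m - j0)"
      using c unfolding cm[symmetric] by simp
    also have "\<dots> \<longleftrightarrow> j = j0"
    proof
      assume "m dvd j + (m - j0)"
      then obtain l where l: "j + (m - j0) = m * l" by (elim dvdE)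
      have "0 < j + (m - j0)" "j + (m - j0) < m * 2" using j j0 by auto
      then have "l = 1" unfolding l using m by auto
      then show "j = j0" using l j0 by simp
    qed (use j0 in auto)
    finally show "coeff r j * y ^ j * (\<Sum>u\<in>K - {0}. u ^ (c * (j + (m - j0)))) =
        (if j = j0 then - (coeff r j * y ^ j) else 0)"
      unfolding sum_power_K[OF K fin] by simp
  qed
  also have "\<dots> = - (coeff r j0 * y ^ j0)" using j0 by simp
  finally have "coeff r j0 * y ^ j0 = - (\<Sum>u\<in>K - {0}. u ^ e * poly r (u ^ c * y))" by simp
  also have "\<dots> \<in> R"
    using conj A(2) R(2)
    by (intro subring_uminus[OF sub] subring_sum[OF sub] subring_mult[OF sub] subring_power[OF sub]) auto
  finally show ?thesis .
qed

section \<open>Behaviour at the zeros of \<open>x^2 + 1\<close>\<close>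

lemma nonunits_K:
  assumes "valuation_ring K R" "a \<in> nonunits R" "a \<in> K"
  shows "a = 0"
  using assms subfield_inverse[OF K, of a] by (auto simp: nonunits_def valuation_ring_def)

lemma exists_place_over:
  assumes d: "d \<in> polys_over K" "degree d > 0"
  obtains R where "valuation_ring K R" "adjoin K x \<subseteq> R" "poly d x \<in> nonunits R"
proof -
  have *: "poly d x \<in> adjoin K x" using d by (auto simp: adjoin_def)
  from exists_valuation_ring[OF K adjoin_subring[OF Kr] adjoin_superset[OF Kr] this
      inverse_poly_notin_adjoin[OF Kr trans d]]
  obtain R where R: "valuation_ring K R" "adjoin K x \<subseteq> R" "inverse (poly d x) \<notin> R" by auto
  with * have "poly d x \<in> nonunits R" by (auto simp: nonunits_def)
  with R that show thesis by blast
qed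

text \<open>Testing at all places over \<open>x^2 + 1\<close> treats the split and the irreducible
  case alike. The remainder \<open>c + d * x\<close> vanishes at these places; its norm
  \<open>c ^ 2 + d ^ 2\<close> is a constant, hence \<open>0\<close>. If \<open>d\<close> is
  nonzero, \<open>a = c / d\<close> is a square root of \<open>- 1\<close>, and at a place where
  \<open>x = a\<close> the remainder reduces to \<open>2 * a * d\<close>, which is nonzero because
  \<open>2\<close> is.\<close>

lemma x2_dvd_if_nonunit:
  assumes W: "W \<in> polys_over K"
    and nonunit: "\<And>R. valuation_ring K R \<Longrightarrow> adjoin K x \<subseteq> R \<Longrightarrow> x ^ 2 + 1 \<in> nonunits R \<Longrightarrow> poly W x \<in> nonunits R"
  shows "\<exists>s\<in>polys_over K. poly W x = (x ^ 2 + 1) * poly s x"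
proof -
  obtain s r where sr: "s \<in> polys_over K" "r \<in> polys_over K" "W = [:1, 0, 1:] * s + r" "\<forall>n\<ge>2. coeff r n = 0"
    using polys_over_division[OF Kr x2_poly _ W] by (auto simp: eval_nat_numeral)
  define c d where "c = coeff r 0" and "d = coeff r 1"
  have cd: "c \<in> K" "d \<in> K" using sr(2) by (auto simp: c_def d_def polys_over_def)
  have "r = [:c, d:]"
    using sr(4) by (intro poly_eqI) (auto simp: c_def d_def coeff_pCons eval_nat_numeral not_less_eq_eq split: nat.split)
  then have W_eq: "poly W x = (x ^ 2 + 1) * poly s x + (c + d * x)"
    by (simp add: sr(3) power2_eq_square algebra_simps)
  have cdx: "c + d * x \<in> nonunits R"
    if R: "valuation_ring K R" "adjoin K x \<subseteq> R" "x ^ 2 + 1 \<in> nonunits R" for R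
  proof -
    interpret total_subring R using R(1) by (rule valuation_ring_total)
    have "- poly s x \<in> R" using sr(1) R(2) by (auto simp: adjoin_def intro!: subring_uminus[OF sub])
    then have "poly W x + (x ^ 2 + 1) * - poly s x \<in> nonunits R"
      by (intro nonunits_add[OF nonunit[OF R] nonunits_mult[OF R(3)]])
    also have "poly W x + (x ^ 2 + 1) * - poly s x = c + d * x"
      unfolding W_eq by (simp only: mult_minus_right add.assoc[symmetric]) simp
    finally show ?thesis .
  qed
  have "c = 0 \<and> d = 0"
  proof (rule ccontr)
    assume nz: "\<not> ?thesis"
    have c2d2: "c ^ 2 + d ^ 2 = 0"
    proof -
      obtain R where R: "valuation_ring K R" "adjoin K x \<subseteq> R" "x ^ 2 + 1 \<in> nonunits R"
        by (rule exists_place_over[OF x2_poly, unfolded poly_x2]) auto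
      interpret total_subring R using R(1) by (rule valuation_ring_total)
      have KR: "K \<subseteq> R" "x \<in> R" using R(2) adjoin_superset[OF Kr, of x] adjoin_gen[OF Kr, of x] by auto
      have "(c + d * x) * (c - d * x) + (x ^ 2 + 1) * d ^ 2 \<in> nonunits R"
        using cd KR
        by (intro nonunits_add[OF nonunits_mult[OF cdx[OF R]] nonunits_mult[OF R(3)]]
            subring_diff[OF sub] subring_mult[OF sub] subring_power[OF sub]) auto
      also have "(c + d * x) * (c - d * x) + (x ^ 2 + 1) * d ^ 2 = c ^ 2 + d ^ 2"
        by (simp add: power2_eq_square algebra_simps)
      finally show ?thesis
        using cd nonunits_K[OF R(1)] by (auto intro: subring_add[OF Kr] subring_power[OF Kr])
    qed
    then have d: "d \<noteq> 0" using nz by auto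
    define a where "a = c / d"
    have a: "a \<in> K" using cd by (simp add: a_def subfield_divide[OF K])
    have a2: "a ^ 2 = - 1" using c2d2 d by (simp add: a_def power_divide field_simps eq_neg_iff_add_eq_0)
    have "[:- a, 1:] \<in> polys_over K" "degree [:- a, 1:] > 0"
      using a by (auto simp: polys_over_pCons[OF Kr] polys_over_0[OF Kr] subring_uminus[OF Kr] subring_1[OF Kr])
    then obtain R where R: "valuation_ring K R" "adjoin K x \<subseteq> R" "poly [:- a, 1:] x \<in> nonunits R"
      by (rule exists_place_over)
    interpret total_subring R using R(1) by (rule valuation_ring_total)
    have KR: "K \<subseteq> R" "x \<in> R" using R(2) adjoin_superset[OF Kr, of x] adjoin_gen[OF Kr, of x] by auto
    have xa: "x - a \<in> nonunits R" using R(3) by simp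
    have "(x - a) * (x + a) \<in> nonunits R"
      using KR a by (intro nonunits_mult[OF xa] subring_add[OF sub]) auto
    also have "(x - a) * (x + a) = x ^ 2 - a ^ 2" by (simp add: power2_eq_square algebra_simps)
    finally have x2: "x ^ 2 + 1 \<in> nonunits R" by (simp add: a2)
    have "inverse d \<in> R" using cd KR subfield_inverse[OF K] by auto
    then have "(c + d * x) * inverse d + (x - a) * - 1 \<in> nonunits R"
      by (intro nonunits_add[OF nonunits_mult[OF cdx[OF R(1,2) x2]] nonunits_mult[OF xa]]
          subring_uminus[OF sub] subring_1[OF sub])
    also have "(c + d * x) * inverse d + (x - a) * - 1 = 2 * a"
      using d by (simp add: a_def field_simps)
    finally have "2 * a = 0"
      by (rule nonunits_K[OF R(1)]) (simp only: mult_2 subring_add[OF Kr a a])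
    then show False using two_neq_0 a2 by simp
  qed
  then have "poly W x = (x ^ 2 + 1) * poly s x" using W_eq by simp
  with sr(1) show ?thesis by (rule bexI[rotated])
qed

text \<open>Since \<open>x\<^sup>2 + 1\<close> is squarefree and \<open>j < m\<close>, the factor \<open>y^j\<close> cannot cancel a pole of \<open>h\<close> at
  a zero of \<open>x\<^sup>2 + 1\<close>.\<close>

lemma component_laurent:
  assumes h: "h \<in> L" and j: "j < m"
    and in_R: "\<And>R. valuation_ring K R \<Longrightarrow> inverse x \<in> R \<Longrightarrow> h * y ^ j \<in> R"
  shows "\<exists>N::nat. h * x ^ N \<in> adjoin K x"
proof (cases "h = 0")
  case True
  then show ?thesis by (simp add: subring_0[OF adjoin_subring[OF Kr]])
next
  case False
  obtain R0 v0 where R0: "kummer_zero K x y m i R0 v0" using zero_exists by auto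
  interpret Z: kummer_zero K x y m i R0 v0 by (rule R0)
  \<comment> \<open>One factor \<open>x^2 + 1\<close> is enough: by the formula for
    \<open>w ^ m\<close>, \<open>w\<close> is regular at the zeros of \<open>x^2 + 1\<close>, and
    the exponent \<open>m - j > 0\<close> even makes it vanish there, so the factor can be divided
    out again.\<close>
  define w where "w = h * (x ^ 2 + 1)"
  have w0: "w \<noteq> 0" using False x2_neq_0 by (simp add: w_def)
  have w_power: "w ^ m = (h * y ^ j) ^ m * x powi (- (i * int j)) * (x ^ 2 + 1) ^ (m - j)"
  proof -
    have "(h * y ^ j) ^ m = h ^ m * (y ^ m) ^ j"
      by (simp add: power_mult_distrib mult.commute flip: power_mult)
    also have "\<dots> = h ^ m * x powi (i * int j) * (x ^ 2 + 1) ^ j"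
      by (simp add: y_power power_mult_distrib power_int_mult)
    finally have "(h * y ^ j) ^ m * x powi (- (i * int j)) * (x ^ 2 + 1) ^ (m - j) =
        h ^ m * ((x ^ 2 + 1) ^ j * (x ^ 2 + 1) ^ (m - j)) * (x powi (i * int j) * x powi (- (i * int j)))"
      by (simp add: mult_ac)
    also have "x powi (i * int j) * x powi (- (i * int j)) = 1"
      using x_neq_0 by (simp flip: power_int_add)
    also have "(x ^ 2 + 1) ^ j * (x ^ 2 + 1) ^ (m - j) = (x ^ 2 + 1) ^ m"
      using j by (simp flip: power_add)
    also have "h ^ m * (x ^ 2 + 1) ^ m * 1 = w ^ m"
      by (simp add: w_def power_mult_distrib)
    finally show ?thesis by (rule sym)
  qed
  \<comment> \<open>\<open>x\<close> has valuation \<open>m >= 1\<close> at \<open>P_0\<close>, so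
    this power of \<open>x\<close> removes any pole of \<open>w\<close> there.\<close>
  define N where "N = nat \<bar>v0 w\<bar>"
  have "w * x ^ N \<in> adjoin K x"
  proof (rule in_adjoin_if_in_valuation_rings[OF K trans])
    show "w * x ^ N \<in> L"
      unfolding w_def using h x_in_L
      by (intro subring_mult[OF Lr] subring_add[OF Lr] subring_power[OF Lr] subring_1[OF Lr])
    fix R assume R: "valuation_ring K R" "adjoin K x \<subseteq> R"
    obtain v where "discrete_valuation R v" using place_discrete[OF R(1)] by auto
    then interpret discrete_valuation R v .
    have xR: "x \<in> R" "K \<subseteq> R" using R(2) adjoin_gen[OF Kr, of x] adjoin_superset[OF Kr, of x] by auto
    show "w * x ^ N \<in> R"
    proof (cases "v x > 0")
      case True
      then interpret A: kummer_zero K x y m i R v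
        using xR by unfold_locales
      have "R = R0" using zero_unique[OF A.kummer_zero_axioms R0] .
      have "v0 (w * x ^ N) = v0 w + int N * int m"
        using w0 x_neq_0 by (simp add: Z.v_mult Z.v_power Z.v_x)
      also have "int N * int m \<ge> int N * 1" using m by (intro mult_left_mono) auto
      then have "v0 w + int N * int m \<ge> 0" by (simp add: N_def)
      finally show ?thesis
        unfolding \<open>R = R0\<close> using w0 x_neq_0 by (simp add: Z.in_iff)
    next
      case False
      then have vx: "v x = 0" using xR x_neq_0 by (simp add: in_iff)
      then have "inverse x \<in> R" using x_neq_0 by (simp add: in_iff v_inverse)
      have "x powi (- (i * int j)) \<in> R" using vx x_neq_0 by (simp add: in_iff v_powi)
      moreover have "(h * y ^ j) ^ m \<in> R"
        by (rule subring_power[OF sub in_R[OF R(1) \<open>inverse x \<in> R\<close>]])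
      moreover have "(x ^ 2 + 1) ^ (m - j) \<in> R"
        using xR by (intro subring_add[OF sub] subring_power[OF sub] subring_1[OF sub])
      ultimately have "w ^ m \<in> R"
        unfolding w_power by (intro subring_mult[OF sub])
      then have "w \<in> R" using m by (rule power_in_imp_in[rotated])
      then show ?thesis using xR by (intro subring_mult[OF sub] subring_power[OF sub])
    qed
  qed
  then obtain W where W2: "w * x ^ N = poly W x" and W1: "W \<in> polys_over K"
    unfolding adjoin_def by (rule imageE)
  have "\<exists>s\<in>polys_over K. poly W x = (x ^ 2 + 1) * poly s x"
  proof (rule x2_dvd_if_nonunit[OF W1])
    fix R assume R: "valuation_ring K R" "adjoin K x \<subseteq> R" "x ^ 2 + 1 \<in> nonunits R"
    obtain v where "discrete_valuation R v" using place_discrete[OF R(1)] by auto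
    then interpret discrete_valuation R v .
    have xR: "x \<in> R" using R(2) adjoin_gen[OF Kr, of x] by auto
    have "x \<notin> nonunits R"
    proof
      assume "x \<in> nonunits R"
      then have "x ^ 2 + 1 + x * - x \<in> nonunits R"
        using xR by (intro nonunits_add[OF R(3)] nonunits_mult subring_uminus[OF sub])
      then show False using one_notin_nonunits by (simp add: power2_eq_square)
    qed
    then have vx: "v x = 0" using xR x_neq_0 by (simp add: in_iff nonunits_v)
    then have "inverse x \<in> R" using x_neq_0 by (simp add: in_iff v_inverse)
    from in_R[OF R(1) this] have "v (h * y ^ j) \<ge> 0" using False y_neq_0 by (simp add: in_iff)
    have "int m * v w = v (w ^ m)" using w0 by (simp add: v_power)
    also have "\<dots> = int m * v (h * y ^ j) + int (m - j) * v (x ^ 2 + 1)"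
    proof -
      have "v (w ^ m) = v ((h * y ^ j) ^ m) + v (x powi (- (i * int j))) + v ((x ^ 2 + 1) ^ (m - j))"
        unfolding w_power using False y_neq_0 x_neq_0 x2_neq_0 by (simp add: v_mult)
      then show ?thesis using vx False y_neq_0 x_neq_0 x2_neq_0 by (simp add: v_power v_powi)
    qed
    also have "\<dots> > 0"
      using \<open>v (h * y ^ j) \<ge> 0\<close> R(3) x2_neq_0 j by (intro add_nonneg_pos mult_pos_pos) (auto simp: nonunits_v)
    finally have "v w > 0" using m by (simp add: zero_less_mult_iff)
    then have "v (w * x ^ N) > 0" using w0 x_neq_0 vx by (simp add: v_mult v_power)
    then have "w * x ^ N \<in> nonunits R" using w0 x_neq_0 by (simp add: nonunits_v)
    then show "poly W x \<in> nonunits R" unfolding W2 .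
  qed
  then obtain s where s: "s \<in> polys_over K" "poly W x = (x ^ 2 + 1) * poly s x" by (rule bexE)
  have "h * x ^ N = poly s x"
    using W2 s(2) x2_neq_0 by (simp add: w_def mult_ac)
  with s(1) show ?thesis by (auto simp: adjoin_def)
qed

end

section \<open>The Weierstrass semigroups\<close>

lemma transcendental_inverse:
  assumes K: "is_subring K" and tr: "transcendental_over K z"
  shows "transcendental_over K (inverse z)"
  unfolding transcendental_over_def
proof (intro allI impI)
  fix p :: "'a poly" assume p: "(\<forall>n. coeff p n \<in> K) \<and> p \<noteq> 0"
  have "z \<noteq> 0"
    using transcendental_overD[OF tr, of "[:0, 1:]"]
    by (auto simp: polys_over_pCons[OF K] polys_over_0[OF K] subring_0[OF K] subring_1[OF K])
  have "reflect_poly p \<in> polys_over K"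
    using p by (auto simp: polys_over_def coeff_reflect_poly subring_0[OF K])
  then have "poly (reflect_poly p) z \<noteq> 0"
    using transcendental_overD[OF tr] p by simp
  then show "poly p (inverse z) \<noteq> 0"
    using \<open>z \<noteq> 0\<close> by (simp add: poly_reflect_poly_nz)
qed

lemma is_subfield_hull: "is_subfield (is_subfield hull S)"
  by (rule hull_in) (auto simp: is_subfield_def is_subring_def)

lemma is_subsemigroup_hull: "is_subsemigroup (is_subsemigroup hull S)"
  by (rule hull_in) (auto simp: is_subsemigroup_def)

lemma hull_generators_add_multiples:
  fixes m :: int
  assumes "m \<in> S" "g \<in> is_subsemigroup hull S"
  shows "g + int k * m \<in> is_subsemigroup hull S"
proof (induction k)
  case (Suc k)
  have "m \<in> is_subsemigroup hull S" using assms(1) by (rule hull_inc)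
  with Suc have "(g + int k * m) + m \<in> is_subsemigroup hull S"
    using is_subsemigroup_hull[of S] unfolding is_subsemigroup_def by blast
  then show ?case by (simp add: algebra_simps)
qed (use assms in simp)

text \<open>\<open>p(z)\<close> is \<open>z ^ degree p\<close> times the reflected polynomial at
  \<open>1/z\<close>, a unit because its constant term is the leading coefficient of
  \<open>p\<close>.\<close>

lemma (in discrete_valuation) v_poly_at_pole:
  assumes K: "is_subfield K" "K \<subseteq> R" and z: "v z < 0" "z \<noteq> 0"
    and p: "p \<in> polys_over K" "p \<noteq> 0"
  shows "v (poly p z) = int (degree p) * v z"
proof -
  have "reflect_poly p \<in> polys_over K"
    using p by (auto simp: polys_over_def coeff_reflect_poly subring_0[OF subfield_subring[OF K(1)]])
  moreover have "coeff (reflect_poly p) 0 \<noteq> 0" using p by simp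
  ultimately have *: "poly (reflect_poly p) (inverse z) \<noteq> 0 \<and> v (poly (reflect_poly p) (inverse z)) = 0"
    using z by (intro v_poly_unit[OF K]) (auto simp: v_inverse)
  have "poly (reflect_poly p) (inverse z) = inverse z ^ degree p * poly p z"
    using z by (subst poly_reflect_poly_nz) auto
  then have "poly p z = z ^ degree p * poly (reflect_poly p) (inverse z)"
    using z by (simp add: field_simps)
  with * z show ?thesis by (simp add: v_mult v_power)
qed

definition regular_outside :: "'a::field set \<Rightarrow> 'a set \<Rightarrow> 'a \<Rightarrow> bool" where
  "regular_outside K R0 f \<longleftrightarrow> (\<forall>R. valuation_ring K R \<longrightarrow> R \<noteq> R0 \<longrightarrow> f \<in> R)"

lemma regular_outside_mult:
  "regular_outside K R0 f \<Longrightarrow> regular_outside K R0 g \<Longrightarrow> regular_outside K R0 (f * g)"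
  by (auto simp: regular_outside_def valuation_ring_def subring_mult)

context kummer
begin

text \<open>Rests on \<open>x^i (x^2 + 1) = x^(i+2) (x^(-2) + 1)\<close>, whose exponent with
  respect to \<open>inverse x\<close> is \<open>- (i + 2)\<close>.\<close>

lemma kummer_inverse:
  assumes "gcd (i + 2) (int m) = 1"
  shows "kummer K (inverse x) y m (- i - 2)"
proof
  show "gcd (- i - 2) (int m) = 1"
    using assms by (metis gcd_neg1 minus_add_distrib uminus_add_conv_diff add.commute diff_minus_eq_add)
  show "transcendental_over K (inverse x)" by (rule transcendental_inverse[OF Kr trans])
  have "inverse x powi (- i - 2) * (inverse x ^ 2 + 1) = x powi (i + 2) * (inverse x ^ 2 + 1)"
    by (simp add: power_int_inverse flip: power_int_minus) (metis minus_diff_eq diff_minus_eq_add add.commute)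
  also have "x powi (i + 2) = x powi i * x ^ 2" using x_neq_0 by (simp add: power_int_add)
  also have "x powi i * x ^ 2 * (inverse x ^ 2 + 1) = x powi i * (x ^ 2 + 1)"
    using x_neq_0 by (simp add: field_simps)
  finally show "y ^ m = inverse x powi (- i - 2) * (inverse x ^ 2 + 1)" by (simp add: y_power)
  let ?H = "is_subfield hull (K \<union> {inverse x, y})"
  have H: "K \<union> {inverse x, y} \<subseteq> ?H" by (rule hull_subset)
  then have "inverse (inverse x) \<in> ?H" by (auto intro: subfield_inverse[OF is_subfield_hull, of "inverse x"] simp del: inverse_inverse_eq)
  then have "x \<in> ?H" unfolding inverse_inverse_eq .
  with H have "is_subfield hull (K \<union> {x, y}) \<subseteq> ?H"
    by (intro hull_minimal is_subfield_hull) auto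
  then show "?H = UNIV" using gen by (simp add: top.extremum_unique)
qed (use K fin odd_card m m_dvd in auto)

lemma pole_exists: "\<exists>R v. valuation_ring K R \<and> discrete_valuation R v \<and> v x < 0"
proof -
  have ad: "inverse (inverse x) \<notin> adjoin K (inverse x)"
    using inverse_poly_notin_adjoin[OF Kr transcendental_inverse[OF Kr trans], of "[:0, 1:]"]
    by (auto simp: polys_over_pCons[OF Kr] polys_over_0[OF Kr] subring_0[OF Kr] subring_1[OF Kr])
  from exists_valuation_ring[OF K adjoin_subring[OF Kr] adjoin_superset[OF Kr] adjoin_gen[OF Kr] this]
  obtain R where R: "valuation_ring K R" "x \<notin> R" by auto
  obtain v where v: "discrete_valuation R v" using place_discrete[OF R(1)] by auto
  then interpret discrete_valuation R v .
  have "v x < 0" using R(2) x_neq_0 in_iff[of x] by auto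
  with R v show ?thesis by auto
qed

lemma the_zero_eq:
  assumes "valuation_ring K R0" "kummer_zero K x y m i R0 v0"
  shows "the_zero K x = nonunits R0"
  unfolding the_zero_def
proof (rule the_equality)
  interpret kummer_zero K x y m i R0 v0 by fact
  show "is_place K (nonunits R0) \<and> val_at (nonunits R0) x > 0"
    using assms(1) vx x_neq_0 by (auto simp: is_place_altdef val_at_eq)
next
  fix P assume P: "is_place K P \<and> val_at P x > 0"
  then obtain R where R: "valuation_ring K R" "P = nonunits R" by (auto simp: is_place_altdef)
  obtain v where "discrete_valuation R v" using place_discrete[OF R(1)] by auto
  then interpret discrete_valuation R v .
  have "kummer_zero K x y m i R v"
    using P R x_neq_0 by unfold_locales (auto simp: val_at_eq valuation_ring_def)
  then show "P = nonunits R0" using zero_unique assms(2) R(2) by metis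
qed

lemma the_pole_eq: "the_pole K x = the_zero K (inverse x)"
proof -
  have "(is_place K P \<and> val_at P x < 0) = (is_place K P \<and> val_at P (inverse x) > 0)" for P
  proof (cases "is_place K P")
    case True
    then obtain R where R: "valuation_ring K R" "P = nonunits R" by (auto simp: is_place_altdef)
    obtain v where "discrete_valuation R v" using place_discrete[OF R(1)] by auto
    then interpret discrete_valuation R v .
    show ?thesis using x_neq_0 by (simp add: R(2) val_at_eq v_inverse)
  qed simp
  then show ?thesis by (simp add: the_pole_def the_zero_def)
qed

text \<open>Pole divisors are compared place by place, using that every place is discrete and
  determines its ring. The \<open>max\<close> covers \<open>n = 0\<close>, where \<open>f\<close>
  may have any nonnegative valuation at the place.\<close>

lemma weierstrass_semigroup_iff:
  assumes "valuation_ring K R0" "discrete_valuation R0 v0"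
  shows "n \<in> weierstrass_semigroup K (nonunits R0) \<longleftrightarrow>
    (\<exists>f. f \<noteq> 0 \<and> regular_outside K R0 f \<and> n = max 0 (- v0 f))"
proof -
  interpret Z: discrete_valuation R0 v0 by fact
  have "pole_divisor K f = (\<lambda>Q. if Q = nonunits R0 then n else 0) \<longleftrightarrow>
      regular_outside K R0 f \<and> n = max 0 (- v0 f)" if f: "f \<noteq> 0" for f n
  proof -
    have pd: "pole_divisor K f (nonunits R) = max 0 (- v f)"
      if R: "valuation_ring K R" "discrete_valuation R v" for R v
      using that f by (auto simp: pole_divisor_def is_place_altdef discrete_valuation.val_at_eq[OF R(2)])
    have pd0: "pole_divisor K f Q = 0" if "\<not> is_place K Q" for Q
      using that by (simp add: pole_divisor_def)
    have regular: "pole_divisor K f (nonunits R) = 0 \<longleftrightarrow> f \<in> R" if R: "valuation_ring K R" for R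
    proof -
      obtain v where v: "discrete_valuation R v" using place_discrete[OF R] by auto
      show ?thesis using f by (auto simp: pd[OF R v] discrete_valuation.in_iff[OF v])
    qed
    have inj: "nonunits R = nonunits R0 \<longleftrightarrow> R = R0" if R: "valuation_ring K R" for R
      using total_subring.ring_at_nonunits[OF valuation_ring_total[OF R]] Z.ring_at_nonunits by metis
    show ?thesis
    proof
      assume *: "pole_divisor K f = (\<lambda>Q. if Q = nonunits R0 then n else 0)"
      show "regular_outside K R0 f \<and> n = max 0 (- v0 f)"
        unfolding regular_outside_def
      proof (intro conjI allI impI)
        fix R assume R: "valuation_ring K R" "R \<noteq> R0"
        then have "pole_divisor K f (nonunits R) = 0" using * inj[OF R(1)] by simp
        then show "f \<in> R" using regular[OF R(1)] by simp
      next
        show "n = max 0 (- v0 f)" using fun_cong[OF *, of "nonunits R0"] pd[OF assms] by simp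
      qed
    next
      assume *: "regular_outside K R0 f \<and> n = max 0 (- v0 f)"
      show "pole_divisor K f = (\<lambda>Q. if Q = nonunits R0 then n else 0)"
      proof
        fix Q
        show "pole_divisor K f Q = (if Q = nonunits R0 then n else 0)"
        proof (cases "is_place K Q")
          case True
          then obtain R where R: "valuation_ring K R" "Q = nonunits R" by (auto simp: is_place_altdef)
          show ?thesis
            using * R inj[OF R(1)] regular[OF R(1)] pd[OF assms] by (auto simp: regular_outside_def)
        next
          case False
          then have "Q \<noteq> nonunits R0" using assms(1) by (auto simp: is_place_altdef)
          then show ?thesis using pd0[OF False] by simp
        qed
      qed
    qed
  qed
  moreover have "n \<ge> 0" if "n = max 0 (- v0 f)" for f using that by simp
  ultimately show ?thesis unfolding weierstrass_semigroup_def by blast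
qed

lemma v_y_general:
  assumes "discrete_valuation R v"
  shows "int m * v y = i * v x + v (x ^ 2 + 1)"
proof -
  interpret discrete_valuation R v by fact
  have "int m * v y = v (y ^ m)" using y_neq_0 by (simp add: v_power)
  also have "\<dots> = i * v x + v (x ^ 2 + 1)"
    unfolding y_power using x_neq_0 x2_neq_0 by (simp add: v_mult v_powi)
  finally show ?thesis .
qed

lemma v_x2_at_pole:
  assumes "valuation_ring K R" "discrete_valuation R v" "v x < 0"
  shows "v (x ^ 2 + 1) = 2 * v x"
proof -
  interpret discrete_valuation R v by fact
  show ?thesis
    using v_poly_at_pole[OF K _ assms(3) x_neq_0 x2_poly] assms(1) unfolding poly_x2
    by (simp add: valuation_ring_def psubset_eq)
qed

text \<open>\<open>R0\<close> is the only place with \<open>v x > 0\<close>. If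
  \<open>v x = 0\<close>, then \<open>x\<close> is a unit and \<open>y\<close> has no pole; at a
  pole of \<open>x\<close>, \<open>v (x^2 + 1) = 2 * v x\<close>, so \<open>m\<close> times the
  valuation is \<open>(s * m - j * (i + 2)) * (- v x)\<close>.\<close>

lemma monomial_regular:
  assumes Z: "kummer_zero K x y m i R0 v0" and s: "s * int m \<ge> int j * (i + 2)"
  shows "regular_outside K R0 (x powi (- s) * y ^ j)"
  unfolding regular_outside_def
proof (intro allI impI)
  fix R assume R: "valuation_ring K R" "R \<noteq> R0"
  obtain v where v: "discrete_valuation R v" using place_discrete[OF R(1)] by auto
  then interpret discrete_valuation R v .
  have KR: "K \<subseteq> R" using R(1) by (auto simp: valuation_ring_def)
  let ?f = "x powi (- s) * y ^ j"
  have f0: "?f \<noteq> 0" using x_neq_0 y_neq_0 by simp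
  have "int m * v ?f = - s * int m * v x + int j * (int m * v y)"
    using x_neq_0 y_neq_0 by (simp add: v_mult v_power v_powi algebra_simps)
  then have mv: "int m * v ?f = - s * int m * v x + int j * (i * v x + v (x ^ 2 + 1))"
    by (simp add: v_y_general[OF v])
  have "\<not> v x > 0"
  proof
    assume "v x > 0"
    then have "kummer_zero K x y m i R v" using KR by unfold_locales
    with R(2) zero_unique Z show False by blast
  qed
  then consider "v x = 0" | "v x < 0" by linarith
  then have "int m * v ?f \<ge> 0"
  proof cases
    case 1
    then have "x ^ 2 + 1 \<in> R"
      using x_neq_0 by (intro subring_add[OF sub] subring_power[OF sub] subring_1[OF sub]) (simp add: in_iff)
    then have "v (x ^ 2 + 1) \<ge> 0" using x2_neq_0 by (simp add: in_iff)
    then show ?thesis unfolding mv 1 by simp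
  next
    case 2
    have "int m * v ?f = (s * int m - int j * (i + 2)) * (- v x)"
      unfolding mv v_x2_at_pole[OF R(1) v 2] by (simp add: algebra_simps)
    also have "\<dots> \<ge> 0" using s 2 by (intro mult_nonneg_nonneg) auto
    finally show ?thesis .
  qed
  then have "v ?f \<ge> 0" using m by (simp add: zero_le_mult_iff)
  then show "?f \<in> R" using f0 by (simp add: in_iff)
qed

text \<open>Only the term attaining \<open>v0 f\<close> matters: as a component of \<open>f\<close>
  it is regular wherever \<open>inverse x\<close> is, so its coefficient is a Laurent polynomial
  that can be bounded at a pole of \<open>x\<close>.\<close>

lemma pole_order_form:
  assumes Z: "kummer_zero K x y m i R0 v0" and f: "f \<noteq> 0" "regular_outside K R0 f"
  shows "\<exists>j s. j < m \<and> s * int m \<ge> int j * (i + 2) \<and> - v0 f = s * int m - int j * i"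
proof -
  interpret Z: kummer_zero K x y m i R0 v0 by fact
  obtain r where r: "r \<in> reps" "f = poly r y" using rep_exists by auto
  then have "r \<noteq> 0" using f by auto
  from Z.v_rep[OF r(1) this] obtain j where j: "j < m" "coeff r j \<noteq> 0" "v0 f = v0 (coeff r j * y ^ j)"
    using r(2) by blast
  define h where "h = coeff r j"
  have h: "h \<in> L" "h \<noteq> 0" using r(1) j(2) by (auto simp: h_def reps_def polys_over_def)
  let ?A = "adjoin K (inverse x)"
  have A: "is_subring ?A" "K \<subseteq> ?A" "inverse x \<in> ?A"
    by (rule adjoin_subring[OF Kr] adjoin_superset[OF Kr] adjoin_gen[OF Kr])+
  have AL: "?A \<subseteq> L"
    using K_subset_L x_in_L by (intro adjoin_least Lr subfield_inverse[OF L])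
  have "x \<in> nonunits R0" using Z.vx x_neq_0 by (simp add: Z.nonunits_v)
  then have x_inv: "inverse x \<notin> R0" using x_neq_0 by (simp add: nonunits_def)
  have f_in: "poly r y \<in> R" if "valuation_ring K R" "?A \<subseteq> R" for R
    using f(2) that A(3) x_inv r(2) unfolding regular_outside_def by blast
  have hy: "h * y ^ j \<in> R" if R: "valuation_ring K R" "inverse x \<in> R" for R
  proof -
    have "?A \<subseteq> R" using R by (intro adjoin_least) (auto simp: valuation_ring_def)
    then show ?thesis
      unfolding h_def by (intro component_in_valuation_rings[OF A(1,2) AL r(1) j(1) f_in R(1)])
  qed
  obtain N p where p: "p \<in> polys_over K" "h * x ^ N = poly p x"
    using component_laurent[OF h(1) j(1) hy] unfolding adjoin_def by blast
  then have "p \<noteq> 0" using h x_neq_0 by auto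
  then obtain n d where d: "d \<in> polys_over K" "coeff d 0 \<noteq> 0" "poly p x = x ^ n * poly d x"
    using poly_factor_x[OF p(1)] by blast
  \<comment> \<open>With the power of \<open>x\<close> extracted from \<open>p\<close>, the factor
    \<open>d\<close> has nonzero constant term, so \<open>h\<close> has valuation exactly
    \<open>- s * m\<close> at \<open>P_0\<close>.\<close>
  define s where "s = int N - int n"
  have h_eq: "h = x powi (- s) * poly d x"
    using p(2) d(3) x_neq_0 by (simp add: s_def power_int_diff field_simps)
  have d0: "d \<noteq> 0" "poly d x \<noteq> 0" using d Z.v_poly by auto
  have "v0 f = - s * int m + int j * i"
    using h d0 x_neq_0 y_neq_0 Z.v_poly[OF d(1,2)]
    by (simp add: j(3) h_eq Z.v_mult Z.v_power Z.v_powi Z.v_x Z.v_y flip: h_def)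
  moreover have "int j * (i + 2) \<le> s * int m"
  proof -
    obtain R v where R: "valuation_ring K R" "discrete_valuation R v" "v x < 0" using pole_exists by auto
    interpret discrete_valuation R v by (rule R(2))
    have "inverse x \<in> R" using R(3) x_neq_0 by (simp add: in_iff v_inverse)
    then have "h * y ^ j \<in> R" by (rule hy[OF R(1)])
    then have "0 \<le> int m * v (h * y ^ j)" using h y_neq_0 by (simp add: in_iff)
    also have "v (h * y ^ j) = - s * v x + int (degree d) * v x + int j * v y"
      using d0 d x_neq_0 y_neq_0 R(1) v_poly_at_pole[OF K _ R(3) x_neq_0 d(1) d0(1)]
      by (simp add: h_eq v_mult v_powi v_power valuation_ring_def psubset_eq)
    also have "int m * \<dots> = - s * int m * v x + int m * int (degree d) * v x + int j * (int m * v y)"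
      by (simp add: algebra_simps)
    also have "\<dots> = (s * int m - int m * int (degree d) - int j * (i + 2)) * (- v x)"
      unfolding v_y_general[OF R(2)] v_x2_at_pole[OF R] by (simp add: algebra_simps)
    finally have "s * int m - int m * int (degree d) - int j * (i + 2) \<ge> 0"
      using R(3) by (subst (asm) zero_le_mult_iff) linarith
    \<comment> \<open>The degree of \<open>d\<close> only strengthens the bound at infinity, so it
      is dropped.\<close>
    moreover have "int m * int (degree d) \<ge> 0" by simp
    ultimately show ?thesis by linarith
  qed
  ultimately show ?thesis using j(1) by (intro exI[of _ j] exI[of _ s]) auto
qed

lemma weierstrass_semigroup_zero:
  "weierstrass_semigroup K (the_zero K x) =
     is_subsemigroup hull ({int m} \<union>
       {\<lceil>real_of_int (l * (i + 2)) / real m\<rceil> * int m - l * i | l. 1 \<le> l \<and> l \<le> int m - 1})"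
  (is "?W = is_subsemigroup hull ?G")
proof -
  obtain R0 v0 where R0: "valuation_ring K R0" "kummer_zero K x y m i R0 v0"
    using zero_exists by auto
  interpret Z: kummer_zero K x y m i R0 v0 by (rule R0)
  have W_iff: "n \<in> ?W \<longleftrightarrow> (\<exists>f. f \<noteq> 0 \<and> regular_outside K R0 f \<and> n = max 0 (- v0 f))" for n
    unfolding the_zero_eq[OF R0] by (rule weierstrass_semigroup_iff[OF R0(1) Z.discrete_valuation_axioms])
  \<comment> \<open>The ceiling is the least \<open>s\<close> satisfying the regularity bound at the
    poles of \<open>x\<close>.\<close>
  have ceil_le: "\<lceil>real_of_int a / real m\<rceil> \<le> s \<longleftrightarrow> a \<le> s * int m" for a s
  proof -
    have "\<lceil>real_of_int a / real m\<rceil> \<le> s \<longleftrightarrow> real_of_int a \<le> real_of_int s * real m"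
      using m by (simp add: ceiling_le_iff divide_le_eq)
    also have "real_of_int s * real m = real_of_int (s * int m)" by simp
    finally show ?thesis by (simp only: of_int_le_iff)
  qed
  have monomial: "s * int m - int j * i \<in> ?W" if "s * int m \<ge> int j * (i + 2)" for s j
  proof -
    have "v0 (x powi (- s) * y ^ j) = - s * int m + int j * i"
      using x_neq_0 y_neq_0 by (simp add: Z.v_mult Z.v_power Z.v_powi Z.v_x Z.v_y)
    moreover have "s * int m - int j * i \<ge> 0" using that by (simp add: algebra_simps)
    ultimately show ?thesis
      unfolding W_iff using monomial_regular[OF R0(2) that] x_neq_0 y_neq_0
      by (intro exI[of _ "x powi (- s) * y ^ j"]) auto
  qed
  have "is_subsemigroup hull ?G \<subseteq> ?W"
  proof (rule hull_minimal)
    have "int m \<in> ?W" using monomial[of 0 1] m by simp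
    moreover have "\<lceil>real_of_int (l * (i + 2)) / real m\<rceil> * int m - l * i \<in> ?W" if "1 \<le> l" for l
    proof -
      have "int (nat l) = l" using that by simp
      then show ?thesis
        using monomial[of "nat l"] iffD1[OF ceil_le[of "l * (i + 2)"] order_refl] by metis
    qed
    ultimately show "?G \<subseteq> ?W" by auto
    have "a + b \<in> ?W" if ab: "a \<in> ?W" "b \<in> ?W" for a b
    \<comment> \<open>If \<open>a = 0\<close>, then \<open>f\<close> may vanish at
      \<open>P_0\<close> and \<open>f * g\<close> need not have pole order \<open>a + b\<close>, so
      zero summands are treated apart.\<close>
    proof (cases "a = 0 \<or> b = 0")
      case True
      then show ?thesis using that by auto
    next
      case False
      from ab(1) obtain f where f: "f \<noteq> 0" "regular_outside K R0 f" "a = max 0 (- v0 f)"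
        unfolding W_iff by blast
      from ab(2) obtain g where g: "g \<noteq> 0" "regular_outside K R0 g" "b = max 0 (- v0 g)"
        unfolding W_iff by blast
      have "a + b = max 0 (- v0 (f * g))" using False f g by (simp add: Z.v_mult max_def split: if_splits)
      with f g show ?thesis unfolding W_iff by (intro exI[of _ "f * g"]) (auto intro: regular_outside_mult)
    qed
    then show "is_subsemigroup ?W"
      using monomial[of 0 0] by (simp add: is_subsemigroup_def)
  qed
  moreover have "?W \<subseteq> is_subsemigroup hull ?G"
  proof
    fix n assume "n \<in> ?W"
    then obtain f where f: "f \<noteq> 0" "regular_outside K R0 f" "n = max 0 (- v0 f)"
      unfolding W_iff by blast
    have zero: "0 \<in> is_subsemigroup hull ?G"
      using is_subsemigroup_hull by (auto simp: is_subsemigroup_def)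
    show "n \<in> is_subsemigroup hull ?G"
    proof (cases "n = 0")
      case False
      then have "n = - v0 f" using f(3) by (simp add: max_def split: if_splits)
      with pole_order_form[OF R0(2) f(1,2)] obtain j s where js: "j < m" "int j * (i + 2) \<le> s * int m"
          "n = s * int m - int j * i" by auto
      let ?c = "\<lceil>real_of_int (int j * (i + 2)) / real m\<rceil>"
      have c: "?c \<le> s" unfolding ceil_le by (rule js(2))
      have "?c * int m - int j * i \<in> is_subsemigroup hull ?G"
      \<comment> \<open>The generators start at \<open>l = 1\<close>; for \<open>j = 0\<close> the
        expression is just \<open>0\<close>.\<close>
      proof (cases "j = 0")
        case True
        then show ?thesis using zero by simp
      next
        case False
        then have "?c * int m - int j * i \<in> ?G"
          using js(1) by (intro UnI2 CollectI exI[of _ "int j"] conjI refl) auto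
        then show ?thesis by (rule hull_inc)
      qed
      then have "?c * int m - int j * i + int (nat (s - ?c)) * int m \<in> is_subsemigroup hull ?G"
        by (intro hull_generators_add_multiples) auto
      then show ?thesis using c by (simp add: js(3) algebra_simps)
    qed (use zero in simp)
  qed
  ultimately show ?thesis by blast
qed

end

theorem theorem3p3:
  fixes K :: "'a::field set" and x y :: 'a and p k q m :: nat and i :: int
  assumes "prime p" and "odd p" and "k > 0" and "q = p ^ k"
    and "m = (q + 1) div 2"
    and "gcd i (int m) = 1" and "gcd (i + 2) (int m) = 1"
    and "is_subfield K" and "card K = q ^ 2"
    and "transcendental_over K x"
    and "y ^ m = x powi i * (x ^ 2 + 1)"
    and "is_subfield hull (K \<union> {x, y}) = UNIV"
  shows "weierstrass_semigroup K (the_zero K x) =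
           is_subsemigroup hull ({int m} \<union>
             {\<lceil>real_of_int (l * (i + 2)) / real m\<rceil> * int m - l * i | l. 1 \<le> l \<and> l \<le> int m - 1}) \<and>
         weierstrass_semigroup K (the_pole K x) =
           is_subsemigroup hull ({int m} \<union>
             {- \<lfloor>real_of_int (l * i) / real m\<rfloor> * int m + l * (i + 2) | l. 1 \<le> l \<and> l \<le> int m - 1})"
proof -
  have "odd q" using assms(2,4) by simp
  then have q: "q > 0" "q + 1 = 2 * m" using assms(5) by (auto intro: odd_pos)
  \<comment> \<open>With \<open>q + 1 = 2 * m\<close>, this factorization shows that
    \<open>m\<close> divides the order of the multiplicative group of \<open>K\<close>.\<close>
  have "q ^ 2 - 1 = (q - 1) * (q + 1)"
    using q(1) by (simp add: power2_eq_square algebra_simps)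
  then have "card K - 1 = (q - 1) * (2 * m)" unfolding assms(9) q(2) .
  then have dvd: "m dvd card K - 1" by simp
  have "finite K" using assms(9) q(1) by (intro card_ge_0_finite) simp
  then interpret Z: kummer K x y m i
    using assms q dvd \<open>odd q\<close> by unfold_locales auto
  interpret P: kummer K "inverse x" y m "- i - 2"
    by (rule Z.kummer_inverse) fact
  \<comment> \<open>The exponent \<open>- i - 2\<close> turns the numerator into
    \<open>- l * i\<close>, and the ceiling of \<open>- a\<close> is minus the floor of
    \<open>a\<close>.\<close>
  have "{\<lceil>real_of_int (l * (- i - 2 + 2)) / real m\<rceil> * int m - l * (- i - 2) | l. 1 \<le> l \<and> l \<le> int m - 1} =
      {- \<lfloor>real_of_int (l * i) / real m\<rfloor> * int m + l * (i + 2) | l. 1 \<le> l \<and> l \<le> int m - 1}"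
    by (simp add: ceiling_def algebra_simps)
  then show ?thesis
    using Z.weierstrass_semigroup_zero P.weierstrass_semigroup_zero Z.the_pole_eq by simp
qed

end
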